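(* \[\chi_{CF}(n)=\Theta(\ln^2 n)\qquad (n\to\infty),\] where $\chi_{CF}(n)=\max\{\chi_{CF}(G): G \text{ a graph with } |V(G)|=n\}$ is the largest conflict-free chromatic number of an $n$-vertex graph.
   Context: All graphs are finite and simple. For a vertex $x$ of a graph $G=(V,E)$, $N(x)=\{y\in V: xy\in E\}$ is its neighborhood and $N[x]=N(x)\cup\{x\}$ its closed neighborhood. A (not necessarily proper) vertex coloring of $G$ is called conflict-free if for each $x\in V$ there exists $y\in N[x]$ whose color is different from the color of each other vertex in $N[x]$. The conflict-free chromatic number $\chi_{CF}(G)$ is the smallest $r$ such that $G$ has a conflict-free coloring with $r$ colors. *)

theory Defs
  imports
    Complex_Main
    "HOL-Library.Landau_Symbols"
    "Graph_Theory.Pair_Digraph"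
begin

text \<open>
  A finite simple graph is a \<^locale>\<open>pair_graph\<close>: a finite vertex set together with a symmetric,
  irreflexive set of vertex pairs, so an edge xy is present as both (x, y) and (y, x).
\<close>

definition nbhd :: "'a pair_pre_digraph \<Rightarrow> 'a \<Rightarrow> 'a set" where
  "nbhd G x = {y \<in> pverts G. (x, y) \<in> parcs G}"

definition closed_nbhd :: "'a pair_pre_digraph \<Rightarrow> 'a \<Rightarrow> 'a set" where
  "closed_nbhd G x = nbhd G x \<union> {x}"

definition conflict_free :: "'a pair_pre_digraph \<Rightarrow> ('a \<Rightarrow> 'c) \<Rightarrow> bool" where
  "conflict_free G c \<longleftrightarrow>
     (\<forall>x \<in> pverts G. \<exists>y \<in> closed_nbhd G x. \<forall>z \<in> closed_nbhd G x - {y}. c y \<noteq> c z)"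

text \<open>The colors available to a coloring with \<open>r\<close> colors are \<open>0, \<dots>, r - 1\<close>; not all of them
  have to be used.\<close>

definition chi_CF :: "'a pair_pre_digraph \<Rightarrow> nat" where
  "chi_CF G = (LEAST r. \<exists>c :: 'a \<Rightarrow> nat. c ` pverts G \<subseteq> {..<r} \<and> conflict_free G c)"

text \<open>Vertices are taken from \<^typ>\<open>nat\<close>; by \<open>chi_CF_le_max_chi_CF\<close> below this loses no generality,
  and by \<open>finite_chi_CF_values\<close> and \<open>chi_CF_values_nonempty\<close> the maximum is over a finite
  nonempty set.\<close>

definition max_chi_CF :: "nat \<Rightarrow> nat" where
  "max_chi_CF n = Max {chi_CF G | G :: nat pair_pre_digraph. pair_graph G \<and> card (pverts G) = n}"

lemma closed_nbhd_subset: "x \<in> pverts G \<Longrightarrow> closed_nbhd G x \<subseteq> pverts G"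
  by (auto simp: closed_nbhd_def nbhd_def)

lemma ex_conflict_free_coloring:
  assumes "finite (pverts G)"
  shows "\<exists>c :: 'a \<Rightarrow> nat. c ` pverts G \<subseteq> {..<card (pverts G)} \<and> conflict_free (G :: 'a pair_pre_digraph) c"
proof -
  obtain c where c: "bij_betw c (pverts G) {0..<card (pverts G)}"
    using ex_bij_betw_finite_nat[OF assms] by blast
  have "conflict_free G c"
    unfolding conflict_free_def
  proof
    fix x assume x: "x \<in> pverts G"
    have "c x \<noteq> c z" if "z \<in> closed_nbhd G x - {x}" for z
      using that c closed_nbhd_subset[OF x] x by (auto simp: bij_betw_def inj_on_def)
    then show "\<exists>y \<in> closed_nbhd G x. \<forall>z \<in> closed_nbhd G x - {y}. c y \<noteq> c z"
      by (intro bexI[of _ x]) (auto simp: closed_nbhd_def)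
  qed
  with c show ?thesis by (intro exI[of _ c]) (auto simp: bij_betw_def)
qed

lemma chi_CF_le_card:
  assumes "finite (pverts G)"
  shows "chi_CF G \<le> card (pverts G)"
  unfolding chi_CF_def by (rule Least_le) (rule ex_conflict_free_coloring[OF assms])

lemma finite_chi_CF_values:
  "finite {chi_CF G | G :: 'a pair_pre_digraph. pair_graph G \<and> card (pverts G) = n}"
  by (rule finite_subset[of _ "{..n}"])
     (auto intro!: chi_CF_le_card
           simp: pair_graph_def pair_digraph_def pair_fin_digraph_def pair_fin_digraph_axioms_def)

lemma chi_CF_values_nonempty:
  "{chi_CF G | G :: nat pair_pre_digraph. pair_graph G \<and> card (pverts G) = n} \<noteq> {}"
proof -
  have "pair_graph \<lparr>pverts = {..<n}, parcs = {}\<rparr>"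
    by unfold_locales (auto simp: symmetric_def)
  moreover have "card (pverts \<lparr>pverts = {..<n}, parcs = {}\<rparr>) = n" by simp
  ultimately show ?thesis by blast
qed

lemma chi_CF_inj_image:
  fixes G :: "'a pair_pre_digraph" and f :: "'a \<Rightarrow> 'b"
  assumes G: "pair_wf_digraph G" and f: "inj_on f (pverts G)"
  defines "H \<equiv> \<lparr>pverts = f ` pverts G, parcs = (\<lambda>(x, y). (f x, f y)) ` parcs G\<rparr>"
  shows "chi_CF H = chi_CF G"
proof -
  interpret pair_wf_digraph G by fact
  have arcs: "(f x, f y) \<in> parcs H \<longleftrightarrow> (x, y) \<in> parcs G" if "x \<in> pverts G" "y \<in> pverts G" for x y
  proof
    assume "(f x, f y) \<in> parcs H"
    then obtain u v where "(u, v) \<in> parcs G" "f x = f u" "f y = f v"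
      by (auto simp: H_def)
    then show "(x, y) \<in> parcs G"
      using inj_onD[OF f, of x u] inj_onD[OF f, of y v] that in_arcsD1 in_arcsD2 by metis
  qed (force simp: H_def)
  have nb: "closed_nbhd H (f x) = f ` closed_nbhd G x" if "x \<in> pverts G" for x
  proof -
    have "nbhd H (f x) = f ` nbhd G x"
    proof -
      have "nbhd H (f x) = {v \<in> f ` pverts G. (f x, v) \<in> parcs H}"
        by (simp add: nbhd_def H_def)
      also have "\<dots> = f ` {y \<in> pverts G. (f x, f y) \<in> parcs H}" by auto
      also have "\<dots> = f ` nbhd G x" using arcs[OF that] by (auto simp: nbhd_def)
      finally show ?thesis .
    qed
    then show ?thesis by (simp add: closed_nbhd_def)
  qed
  have cf: "conflict_free H c \<longleftrightarrow> conflict_free G (c \<circ> f)" for c :: "'b \<Rightarrow> nat"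
  proof -
    have "(\<exists>y \<in> closed_nbhd H (f x). \<forall>z \<in> closed_nbhd H (f x) - {y}. c y \<noteq> c z) \<longleftrightarrow>
          (\<exists>y \<in> closed_nbhd G x. \<forall>z \<in> closed_nbhd G x - {y}. (c \<circ> f) y \<noteq> (c \<circ> f) z)"
      if x: "x \<in> pverts G" for x
    proof -
      have "f ` closed_nbhd G x - {f y} = f ` (closed_nbhd G x - {y})" if "y \<in> closed_nbhd G x" for y
        using that closed_nbhd_subset[OF x] f by (auto simp: inj_on_def)
      then show ?thesis by (auto simp: nb[OF x])
    qed
    then show ?thesis by (simp add: conflict_free_def H_def)
  qed
  have cong: "conflict_free G c \<longleftrightarrow> conflict_free G d"
    if "\<And>x. x \<in> pverts G \<Longrightarrow> c x = d x" for c d :: "'a \<Rightarrow> nat"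
    unfolding conflict_free_def
    by (intro ball_cong bex_cong refl) (metis DiffD1 closed_nbhd_subset subsetD that)
  have "(\<exists>c. c ` pverts H \<subseteq> {..<r} \<and> conflict_free H c) \<longleftrightarrow>
        (\<exists>c. c ` pverts G \<subseteq> {..<r} \<and> conflict_free G c)" for r :: nat
  proof
    assume "\<exists>c. c ` pverts H \<subseteq> {..<r} \<and> conflict_free H c"
    then obtain c where "c ` pverts H \<subseteq> {..<r}" "conflict_free H c" by blast
    then show "\<exists>c. c ` pverts G \<subseteq> {..<r} \<and> conflict_free G c"
      by (intro exI[of _ "c \<circ> f"]) (simp add: cf[symmetric], simp add: H_def image_comp)
  next
    assume "\<exists>c. c ` pverts G \<subseteq> {..<r} \<and> conflict_free G c"
    then obtain c where c: "c ` pverts G \<subseteq> {..<r}" "conflict_free G c" by blast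
    define d where "d = c \<circ> inv_into (pverts G) f"
    have eq: "(d \<circ> f) x = c x" if "x \<in> pverts G" for x
      using that f by (simp add: d_def)
    have "d ` pverts H \<subseteq> {..<r}" using c eq by (auto simp: H_def)
    moreover have "conflict_free H d" using cong[of "d \<circ> f" c] eq c by (simp add: cf)
    ultimately show "\<exists>c. c ` pverts H \<subseteq> {..<r} \<and> conflict_free H c" by blast
  qed
  then show ?thesis unfolding chi_CF_def by simp
qed

lemma chi_CF_le_max_chi_CF:
  fixes G :: "'a pair_pre_digraph"
  assumes G: "pair_graph G"
  shows "chi_CF G \<le> max_chi_CF (card (pverts G))"
proof -
  interpret pair_graph G by fact
  obtain f :: "'a \<Rightarrow> nat" where f: "inj_on f (pverts G)"
    using finite_imp_inj_to_nat_seg[OF pair_finite_verts] by blast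
  define H where "H = \<lparr>pverts = f ` pverts G, parcs = (\<lambda>(x, y). (f x, f y)) ` parcs G\<rparr>"
  have "pair_graph H"
  proof unfold_locales
    have "sym (parcs G)" using pair_sym_arcs by (simp add: symmetric_def)
    then have "sym (parcs H)"
      unfolding H_def by (fastforce intro: symI dest: symD)
    then show "symmetric (with_proj H)" by (simp add: symmetric_def)
    show "fst e \<noteq> snd e" if "e \<in> parcs H" for e
    proof -
      from that obtain u v where "(u, v) \<in> parcs G" "e = (f u, f v)" by (auto simp: H_def)
      then show ?thesis using inj_onD[OF f, of u v] no_loops' in_arcsD1 in_arcsD2 by auto
    qed
  qed (use in_arcsD1 in_arcsD2 pair_finite_verts pair_finite_arcs in \<open>auto simp: H_def\<close>)
  moreover have "card (pverts H) = card (pverts G)" using f by (simp add: H_def card_image)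
  moreover have "chi_CF H = chi_CF G"
    unfolding H_def using pair_wf_digraph f by (rule chi_CF_inj_image)
  ultimately have "chi_CF G \<in> {chi_CF G' | G' :: nat pair_pre_digraph.
      pair_graph G' \<and> card (pverts G') = card (pverts G)}" by force
  then show ?thesis unfolding max_chi_CF_def by (rule Max_ge[OF finite_chi_CF_values])
qed

end

theory Submission
  imports Defs "HOL-Real_Asymp.Real_Asymp"
begin

text \<open>
  Upper bound. Repeatedly deleting a vertex of degree below L gives a set S that is properly
  L-colorable, so each vertex of S is itself the unique vertex of its color, and every vertex
  outside S has at least L neighbors outside S. With L of order ln n, color the rest by choosing
  color classes one after another, each containing every still uncolored vertex with probability
  1/L. The number of uncolored vertices of a neighborhood shrinks by a factor 1 - 1/L per step, so
  for about L/2 of the first L ln n + O(L) steps it is comparable to L, and each of these steps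
  has a constant chance of hitting the neighborhood exactly once. Hence all neighborhoods are
  served with positive probability.

  Lower bound. Give the vertices levels 1, ..., l with l of order ln n and join u and v
  independently with probability 2^-(level u + level v). A vertex of level i then expects
  2^-i w(C) neighbors in a set C, where w(C) does not depend on i, and has exactly one with
  probability at most about y exp(-y) for y = 2^-i w(C). Summed over i this is O(1), so for any r
  color classes some level i has at least exp(-O(r/l)) as the probability of seeing no class
  exactly once; for r = l^2 this is a small negative power of n. The union bound over all
  colorings is made affordable by ignoring the classes with more than sqrt n vertices: almost every
  vertex has two neighbors in a given large set, and the small classes together have few vertices.
\<close>

section \<open>Random subsets of a finite set\<close>

text \<open>The expectation of \<open>f E\<close> for a random subset \<open>E\<close> of \<open>I\<close> that contains each \<open>i\<close>
  independently with probability \<open>p i\<close>.\<close>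

definition bexp :: "('i \<Rightarrow> real) \<Rightarrow> 'i set \<Rightarrow> ('i set \<Rightarrow> real) \<Rightarrow> real" where
  "bexp p I f = (\<Sum>E\<in>Pow I. (\<Prod>i\<in>E. p i) * (\<Prod>i\<in>I - E. 1 - p i) * f E)"

lemma bexp_empty [simp]: "bexp p {} f = f {}"
  by (simp add: bexp_def)

lemma bexp_add: "bexp p I (\<lambda>E. f E + g E) = bexp p I f + bexp p I g"
  by (simp add: bexp_def distrib_left sum.distrib)

lemma bexp_sum: "bexp p I (\<lambda>E. \<Sum>a\<in>A. f a E) = (\<Sum>a\<in>A. bexp p I (f a))"
  unfolding bexp_def sum_distrib_left by (rule sum.swap)

lemma bexp_cong: "(\<And>E. E \<subseteq> I \<Longrightarrow> f E = g E) \<Longrightarrow> bexp p I f = bexp p I g"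
  by (auto simp: bexp_def intro!: sum.cong)

lemma bexp_weight_nonneg:
  assumes "\<And>i. i \<in> I \<Longrightarrow> 0 \<le> p i \<and> p i \<le> 1" "E \<subseteq> I"
  shows "0 \<le> (\<Prod>i\<in>E. p i) * (\<Prod>i\<in>I - E. 1 - p i :: real)"
  using assms by (intro mult_nonneg_nonneg prod_nonneg) auto

lemma bexp_mono:
  assumes "\<And>i. i \<in> I \<Longrightarrow> 0 \<le> p i \<and> p i \<le> 1" "\<And>E. E \<subseteq> I \<Longrightarrow> f E \<le> g E"
  shows "bexp p I f \<le> bexp p I g"
  unfolding bexp_def using assms by (intro sum_mono mult_left_mono bexp_weight_nonneg) auto

text \<open>Independence of disjoint blocks of coordinates: a subset of \<open>I \<union> J\<close>
  is a pair of subsets, and its weight is the product of theirs.\<close>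

lemma bexp_Un_times:
  assumes "finite I" "finite J" "I \<inter> J = {}"
  shows "bexp p (I \<union> J) (\<lambda>E. f (E \<inter> I) * g (E \<inter> J)) = bexp p I f * bexp p J g"
proof -
  have bij: "bij_betw (\<lambda>(A, B). A \<union> B) (Pow I \<times> Pow J) (Pow (I \<union> J))"
  proof (rule bij_betw_byWitness[where f' = "\<lambda>E. (E \<inter> I, E \<inter> J)"])
  qed (use assms in auto)
  have "bexp p (I \<union> J) (\<lambda>E. f (E \<inter> I) * g (E \<inter> J)) =
    (\<Sum>(A, B)\<in>Pow I \<times> Pow J. (\<Prod>i\<in>A \<union> B. p i) * (\<Prod>i\<in>I \<union> J - (A \<union> B). 1 - p i)
       * (f ((A \<union> B) \<inter> I) * g ((A \<union> B) \<inter> J)))"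
    unfolding bexp_def by (subst sum.reindex_bij_betw[OF bij, symmetric]) (auto intro: sum.cong)
  also have "\<dots> = (\<Sum>(A, B)\<in>Pow I \<times> Pow J.
      ((\<Prod>i\<in>A. p i) * (\<Prod>i\<in>I - A. 1 - p i) * f A) * ((\<Prod>i\<in>B. p i) * (\<Prod>i\<in>J - B. 1 - p i) * g B))"
  proof (intro sum.cong refl, clarify)
    fix A B assume AB: "A \<subseteq> I" "B \<subseteq> J"
    have fin: "finite A" "finite B" using AB assms by (auto intro: finite_subset)
    have 1: "(\<Prod>i\<in>A \<union> B. p i) = (\<Prod>i\<in>A. p i) * (\<Prod>i\<in>B. p i)"
      using AB assms fin by (intro prod.union_disjoint) auto
    have "I \<union> J - (A \<union> B) = (I - A) \<union> (J - B)" using AB assms by auto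
    then have 2: "(\<Prod>i\<in>I \<union> J - (A \<union> B). 1 - p i) = (\<Prod>i\<in>I - A. 1 - p i) * (\<Prod>i\<in>J - B. 1 - p i)"
      using AB assms fin by (simp, intro prod.union_disjoint) auto
    have 3: "(A \<union> B) \<inter> I = A" "(A \<union> B) \<inter> J = B" using AB assms by auto
    show "(\<Prod>i\<in>A \<union> B. p i) * (\<Prod>i\<in>I \<union> J - (A \<union> B). 1 - p i)
       * (f ((A \<union> B) \<inter> I) * g ((A \<union> B) \<inter> J)) = 
       ((\<Prod>i\<in>A. p i) * (\<Prod>i\<in>I - A. 1 - p i) * f A) * ((\<Prod>i\<in>B. p i) * (\<Prod>i\<in>J - B. 1 - p i) * g B)"
      unfolding 1 2 3 by (simp add: mult_ac)
  qed
  also have "\<dots> = bexp p I f * bexp p J g"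
    unfolding bexp_def by (simp add: sum_product sum.cartesian_product)
  finally show ?thesis .
qed

text \<open>Conditions on whether \<open>a\<close> is chosen; this drives the inductions over the
  index set.\<close>

lemma bexp_insert:
  assumes "finite I" "a \<notin> I"
  shows "bexp p (insert a I) f = p a * bexp p I (\<lambda>E. f (insert a E)) + (1 - p a) * bexp p I f"
proof -
  have inj: "inj_on (insert a) (Pow I)" using assms by (auto simp: inj_on_def)
  have "bexp p (insert a I) f =
      (\<Sum>E\<in>Pow I. (\<Prod>i\<in>E. p i) * (\<Prod>i\<in>insert a I - E. 1 - p i) * f E)
    + (\<Sum>E\<in>Pow I. (\<Prod>i\<in>insert a E. p i) * (\<Prod>i\<in>insert a I - insert a E. 1 - p i) * f (insert a E))"
    unfolding bexp_def Pow_insert using assms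
    by (subst sum.union_disjoint) (auto simp: sum.reindex[OF inj])
  also have "(\<Sum>E\<in>Pow I. (\<Prod>i\<in>E. p i) * (\<Prod>i\<in>insert a I - E. 1 - p i) * f E) = (1 - p a) * bexp p I f"
    unfolding bexp_def sum_distrib_left
  proof (intro sum.cong refl)
    fix E assume E: "E \<in> Pow I"
    then have "insert a I - E = insert a (I - E)" using assms by auto
    then show "(\<Prod>i\<in>E. p i) * (\<Prod>i\<in>insert a I - E. 1 - p i) * f E
       = (1 - p a) * ((\<Prod>i\<in>E. p i) * (\<Prod>i\<in>I - E. 1 - p i) * f E)"
      using assms by (simp add: mult_ac)
  qed
  also have "(\<Sum>E\<in>Pow I. (\<Prod>i\<in>insert a E. p i) * (\<Prod>i\<in>insert a I - insert a E. 1 - p i) * f (insert a E))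
     = p a * bexp p I (\<lambda>E. f (insert a E))"
    unfolding bexp_def sum_distrib_left
  proof (intro sum.cong refl)
    fix E assume E: "E \<in> Pow I"
    then have "insert a I - insert a E = I - E" "a \<notin> E" "finite E" using assms finite_subset by auto
    then show "(\<Prod>i\<in>insert a E. p i) * (\<Prod>i\<in>insert a I - insert a E. 1 - p i) * f (insert a E)
       = p a * ((\<Prod>i\<in>E. p i) * (\<Prod>i\<in>I - E. 1 - p i) * f (insert a E))"
      by (simp add: mult_ac)
  qed
  finally show ?thesis by simp
qed

lemma bexp_const [simp]: "finite I \<Longrightarrow> bexp p I (\<lambda>_. c) = c"
  by (induction I rule: finite_induct) (simp_all add: bexp_insert algebra_simps)

text \<open>Marginals: the coordinates outside \<open>S\<close> contribute a factor 1.\<close>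

lemma bexp_restrict:
  assumes "finite I" "S \<subseteq> I"
  shows "bexp p I (\<lambda>E. f (E \<inter> S)) = bexp p S f"
proof -
  have "bexp p (S \<union> (I - S)) (\<lambda>E. f (E \<inter> S) * 1) = bexp p S f * bexp p (I - S) (\<lambda>_. 1)"
    using assms finite_subset by (intro bexp_Un_times) auto
  then show ?thesis using assms by (simp add: Un_absorb1)
qed

text \<open>Mutual independence, by splitting off one block at a time. Coordinates in no block are
  left to the base case, where they integrate to 1.\<close>

lemma bexp_UN_prod:
  assumes "finite A" "finite I" "\<And>x. x \<in> A \<Longrightarrow> J x \<subseteq> I" "disjoint_family_on J A"
  shows "bexp p I (\<lambda>E. \<Prod>x\<in>A. f x (E \<inter> J x)) = (\<Prod>x\<in>A. bexp p (J x) (f x))"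
  using assms
proof (induction A arbitrary: I rule: finite_induct)
  case empty
  then show ?case by simp
next
  case (insert a A)
  have dis: "J x \<subseteq> I - J a" if "x \<in> A" for x
    using that insert.prems insert.hyps by (fastforce simp: disjoint_family_on_def)
  have "bexp p I (\<lambda>E. \<Prod>x\<in>insert a A. f x (E \<inter> J x)) =
    bexp p (J a \<union> (I - J a)) (\<lambda>E. f a (E \<inter> J a) * (\<Prod>x\<in>A. f x (E \<inter> (I - J a) \<inter> J x)))"
  proof -
    have "(\<Prod>x\<in>A. f x (E \<inter> (I - J a) \<inter> J x)) = (\<Prod>x\<in>A. f x (E \<inter> J x))" for E
      using dis by (intro prod.cong refl arg_cong[where f = "f _"]) auto
    then show ?thesis using insert.hyps insert.prems(2)[of a] by (simp add: Un_absorb1)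
  qed
  also have "\<dots> = bexp p (J a) (f a) * bexp p (I - J a) (\<lambda>E. \<Prod>x\<in>A. f x (E \<inter> J x))"
    using insert.prems finite_subset[of "J a" I] by (intro bexp_Un_times) auto
  also have "bexp p (I - J a) (\<lambda>E. \<Prod>x\<in>A. f x (E \<inter> J x)) = (\<Prod>x\<in>A. bexp p (J x) (f x))"
    using insert.prems dis by (intro insert.IH) (auto simp: disjoint_family_on_def)
  finally show ?case using insert.hyps by simp
qed

text \<open>The first moment method: not every outcome can exceed the mean.\<close>

lemma exists_le_bexp:
  assumes "finite I" "\<And>i. i \<in> I \<Longrightarrow> 0 \<le> p i \<and> p i \<le> 1" "bexp p I f < c"
  shows "\<exists>E\<subseteq>I. f E < c"
proof (rule ccontr)
  assume "\<not> ?thesis"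
  then have "bexp p I (\<lambda>_. c) \<le> bexp p I f"
    using assms by (intro bexp_mono) (auto simp: not_less)
  with assms show False by simp
qed

text \<open>With constant \<open>p\<close> the size is binomially distributed; the sum is grouped by
  size.\<close>

lemma bexp_card:
  assumes "finite S"
  shows "bexp (\<lambda>_. p) S (\<lambda>E. g (card E)) =
    (\<Sum>k\<le>card S. real (card S choose k) * p ^ k * (1 - p) ^ (card S - k) * g k)"
proof -
  have "bexp (\<lambda>_. p) S (\<lambda>E. g (card E)) = (\<Sum>E\<in>Pow S. p ^ card E * (1 - p) ^ (card S - card E) * g (card E))"
    unfolding bexp_def using assms by (intro sum.cong) (auto simp: card_Diff_subset finite_subset)
  also have "\<dots> = (\<Sum>k\<le>card S. \<Sum>E | E \<in> Pow S \<and> card E = k. p ^ card E * (1 - p) ^ (card S - card E) * g (card E))"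
    using assms by (intro sum.group[symmetric]) (auto intro: card_mono)
  also have "\<dots> = (\<Sum>k\<le>card S. real (card S choose k) * (p ^ k * (1 - p) ^ (card S - k) * g k))"
    using n_subsets[OF assms] by (intro sum.cong refl) simp
  finally show ?thesis by (simp add: mult_ac)
qed

section \<open>The upper bound\<close>

text \<open>
  \<open>miss_prob p m s\<close> is the probability that none of \<open>m\<close> successive color classes meets an
  \<open>s\<close>-element set in exactly one point, when each class takes every point that is left with
  probability \<open>p\<close>.
\<close>

primrec miss_prob :: "real \<Rightarrow> nat \<Rightarrow> nat \<Rightarrow> real" where
  "miss_prob p 0 s = 1"
| "miss_prob p (Suc m) s =
     (\<Sum>k\<in>{..s} - {1}. real (s choose k) * p ^ k * (1 - p) ^ (s - k) * miss_prob p m (s - k))"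

text \<open>The exponential series without its linear term, truncated. Up to the factor
  \<open>exp z\<close>, the right side is the probability that a Poisson variable of mean
  \<open>z\<close> differs from 1.\<close>

lemma exp_partial_sum_except_one:
  fixes z :: real
  assumes "z \<ge> 0"
  shows "(\<Sum>k\<in>{..s} - {1}. z ^ k / fact k) \<le> exp z - z"
proof -
  \<comment> \<open>Inserting 1 makes the linear term present even when
    \<open>s = 0\<close>.\<close>
  have "(\<Sum>k\<in>insert 1 ({..s} - {1}). inverse (fact k) * z ^ k) \<le> (\<Sum>k. inverse (fact k) * z ^ k)"
    using assms by (intro sum_le_suminf summable_exp) auto
  also have "\<dots> = exp z" by (simp add: exp_def scaleR_conv_of_real)
  finally have "(\<Sum>k\<in>insert 1 ({..s} - {1}). inverse (fact k) * z ^ k) \<le> exp z" .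
  then have "inverse (fact 1) * z ^ 1 + (\<Sum>k\<in>{..s} - {1}. inverse (fact k) * z ^ k) \<le> exp z"
    by (subst (asm) sum.insert) auto
  then show ?thesis by (simp add: divide_inverse mult.commute)
qed

lemma one_minus_mult_exp_nonneg: "0 \<le> 1 - y * exp (- y :: real)"
proof -
  have "y \<le> exp y" using exp_ge_add_one_self[of y] by linarith
  then show ?thesis by (simp add: exp_minus field_simps)
qed

text \<open>
  Poissonization: if the size of the set were Poisson with mean \<open>r\<close>, the numbers of points in the
  successive classes would be independent Poisson variables with means \<open>p * (1 - p) ^ j * r\<close>, and
  the probability would be the product. The factor in front is the price for conditioning on size
  \<open>s\<close>; by \<open>fact_mult_exp_le\<close> it is only linear in \<open>s\<close> for \<open>r = s\<close>.
\<close>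

lemma miss_prob_le:
  assumes p: "0 < p" "p < 1" and r: "r > 0"
  shows "miss_prob p m s \<le> fact s * exp r / r ^ s *
    (\<Prod>j<m. 1 - (p * (1 - p) ^ j * r) * exp (- (p * (1 - p) ^ j * r)))"
  using r
proof (induction m arbitrary: s r)
  case 0
  have "(\<Sum>k\<in>{s}. inverse (fact k) * r ^ k) \<le> (\<Sum>k. inverse (fact k) * r ^ k)"
    using 0 by (intro sum_le_suminf summable_exp) auto
  also have "\<dots> = exp r" by (simp add: exp_def scaleR_conv_of_real)
  finally show ?case using 0 by (simp add: field_simps)
next
  case (Suc m)
  \<comment> \<open>Poisson thinning: the points left after the first class have mean
    \<open>(1 - p) * r\<close>, so the induction hypothesis is used at this smaller mean.\<close>
  define r' where "r' = (1 - p) * r"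
  define Q where "Q = (\<Prod>j<m. 1 - (p * (1 - p) ^ j * r') * exp (- (p * (1 - p) ^ j * r')))"
  have r': "r' > 0" using Suc.prems p by (simp add: r'_def)
  have Q: "Q \<ge> 0" unfolding Q_def by (intro prod_nonneg ballI one_minus_mult_exp_nonneg)
  have "miss_prob p (Suc m) s \<le> (\<Sum>k\<in>{..s} - {1}. real (s choose k) * p ^ k * (1 - p) ^ (s - k)
        * (fact (s - k) * exp r' / r' ^ (s - k) * Q))"
    unfolding miss_prob.simps Q_def using p r' by (intro sum_mono mult_left_mono Suc.IH) auto
  also have "\<dots> = (\<Sum>k\<in>{..s} - {1}. fact s / r ^ s * exp r' * Q * ((p * r) ^ k / fact k))"
  proof (intro sum.cong refl)
    fix k assume "k \<in> {..s} - {1}"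
    then have k: "k \<le> s" by simp
    have 1: "real (s choose k) * fact (s - k) = fact s / fact k"
      using binomial_fact[OF k, where 'a = real] by simp
    have 2: "(1 - p) ^ (s - k) / r' ^ (s - k) = r ^ k / r ^ s"
      using p Suc.prems k by (simp add: r'_def power_mult_distrib power_diff)
    have "real (s choose k) * p ^ k * (1 - p) ^ (s - k) * (fact (s - k) * exp r' / r' ^ (s - k) * Q)
      = (real (s choose k) * fact (s - k)) * p ^ k * ((1 - p) ^ (s - k) / r' ^ (s - k)) * exp r' * Q"
      by simp
    also have "\<dots> = fact s / r ^ s * exp r' * Q * ((p * r) ^ k / fact k)"
      unfolding 1 2 by (simp add: power_mult_distrib mult_ac)
    finally show "real (s choose k) * p ^ k * (1 - p) ^ (s - k)
        * (fact (s - k) * exp r' / r' ^ (s - k) * Q) = fact s / r ^ s * exp r' * Q * ((p * r) ^ k / fact k)" .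
  qed
  also have "\<dots> \<le> fact s / r ^ s * exp r' * Q * (exp (p * r) - p * r)"
    unfolding sum_distrib_left[symmetric] using p Suc.prems Q
    by (intro mult_left_mono exp_partial_sum_except_one) auto
  also have "exp (p * r) - p * r = exp (p * r) * (1 - (p * r) * exp (- (p * r)))"
    by (simp add: algebra_simps exp_minus_inverse)
  also have "fact s / r ^ s * exp r' * Q * (exp (p * r) * (1 - (p * r) * exp (- (p * r))))
    = fact s * exp r / r ^ s * ((1 - (p * r) * exp (- (p * r))) * Q)"
  proof -
    have "exp r = exp r' * exp (p * r)" by (simp add: r'_def exp_add[symmetric] algebra_simps)
    then show ?thesis by simp
  qed
  also have "(1 - (p * r) * exp (- (p * r))) * Q =
     (\<Prod>j<Suc m. 1 - (p * (1 - p) ^ j * r) * exp (- (p * (1 - p) ^ j * r)))"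
    unfolding prod.lessThan_Suc_shift Q_def r'_def by (simp add: mult_ac)
  finally show ?case .
qed

text \<open>A weak Stirling bound. The induction step reduces to
  \<open>(1 - 1 / (s + 1)) ^ (s + 1) \<le> exp (- 1)\<close>.\<close>

lemma fact_mult_exp_le:
  assumes "s \<ge> 1"
  shows "fact s * exp (real s) \<le> exp 1 * real s * real s ^ s"
  using assms
proof (induction s rule: dec_induct)
  case base
  then show ?case by simp
next
  case (step s)
  have s: "s \<ge> 1" using step by simp
  have "exp 1 * real s ^ Suc s \<le> real (Suc s) ^ Suc s"
  proof -
    have "1 + (- 1 / (real s + 1)) \<le> exp (- 1 / (real s + 1))" by (rule exp_ge_add_one_self)
    then have "(real s / (real s + 1)) ^ Suc s \<le> exp (- 1 / (real s + 1)) ^ Suc s"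
      by (intro power_mono) (auto simp: field_simps)
    also have "\<dots> = exp (real (Suc s) * (- 1 / (real s + 1)))"
      by (simp only: exp_of_nat_mult)
    also have "real (Suc s) * (- 1 / (real s + 1)) = - 1" by (simp add: field_simps)
    finally have "real s ^ Suc s / real (Suc s) ^ Suc s \<le> inverse (exp 1)"
      unfolding power_divide by (simp only: exp_minus of_nat_Suc add.commute)
    then have "real s ^ Suc s \<le> inverse (exp 1) * real (Suc s) ^ Suc s"
      by (subst (asm) pos_divide_le_eq) auto
    then have "exp 1 * real s ^ Suc s \<le> exp 1 * (inverse (exp 1) * real (Suc s) ^ Suc s)"
      by (intro mult_left_mono) auto
    then show ?thesis by (simp only: mult.assoc[symmetric]) simp
  qed
  then have *: "exp 1 * (real s * real s ^ s) \<le> real (Suc s) ^ Suc s" by simp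
  have "fact (Suc s) * exp (real (Suc s)) = real (Suc s) * exp 1 * (fact s * exp (real s))"
    by (simp add: exp_add)
  also have "\<dots> \<le> real (Suc s) * exp 1 * (exp 1 * real s * real s ^ s)"
    by (intro mult_left_mono step.IH) auto
  also have "\<dots> \<le> real (Suc s) * exp 1 * (real (Suc s) ^ Suc s)"
    using * by (intro mult_left_mono) (auto simp: mult_ac)
  finally show ?case by (simp add: mult_ac)
qed

text \<open>The numbers \<open>x * q ^ j\<close> with \<open>q = 1 - 1 / (2 * h)\<close> fall from
  at least 1 to at most 1 within \<open>J\<close> steps and then stay in \<open>[1/2, 1]\<close> for
  \<open>h\<close> steps. Each of these \<open>h\<close> factors is at most
  \<open>exp (- 1 / 6)\<close>, and all others are at most 1. Where the window starts depends on
  \<open>x\<close>, hence the \<open>J + h\<close> steps.\<close>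

lemma prod_le_window:
  fixes h :: nat
  assumes h: "h \<ge> 1" and x: "1 \<le> x" "x * exp (- real J / real (2 * h)) \<le> 1"
  shows "(\<Prod>j<J + h. 1 - (x * (1 - 1 / real (2 * h)) ^ j) * exp (- (x * (1 - 1 / real (2 * h)) ^ j)))
         \<le> exp (- real h / 6)"
proof -
  define q where "q = 1 - 1 / real (2 * h)"
  define y where "y j = x * q ^ j" for j
  have q: "0 < q" "q < 1" using h by (auto simp: q_def field_simps)
  have "q \<le> exp (- 1 / real (2 * h))"
    using exp_ge_add_one_self[of "- 1 / real (2 * h)"] by (simp add: q_def)
  then have "q ^ J \<le> exp (- 1 / real (2 * h)) ^ J" using q by (intro power_mono) auto
  also have "\<dots> = exp (real J * (- 1 / real (2 * h)))" by (simp only: exp_of_nat_mult)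
  also have "\<dots> = exp (- real J / real (2 * h))" by simp
  finally have yJ: "y J \<le> 1" unfolding y_def using x
    by (meson mult_left_mono order_trans zero_le_one)
  define a where "a = (LEAST j. y j \<le> 1)"
  have a: "y a \<le> 1" unfolding a_def by (rule LeastI[of _ J]) (rule yJ)
  have aJ: "a \<le> J" unfolding a_def by (rule Least_le) (rule yJ)
  \<comment> \<open>The value before the first one below 1 exceeds 1, and one step costs only a
    factor \<open>q\<close>.\<close>
  have ya: "y a \<ge> q"
  proof (cases a)
    case 0
    then show ?thesis using x q by (simp add: y_def)
  next
    case (Suc b)
    then have "\<not> y b \<le> 1" unfolding a_def by (intro not_less_Least) simp
    then show ?thesis using Suc q by (simp add: y_def mult_less_cancel_left mult_ac)
  qed
  have win: "1 / 2 \<le> y (a + k)" "y (a + k) \<le> 1" if k: "k < h" for k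
  proof -
    \<comment> \<open>Bernoulli: \<open>Suc k \<le> h\<close> factors \<open>q\<close> lose at most
      one half. The extra factor pays for \<open>y a\<close> being only at least
      \<open>q\<close>.\<close>
    have "1 / 2 \<le> 1 + real (Suc k) * (- 1 / real (2 * h))" using k h by (simp add: field_simps)
    also have "\<dots> \<le> (1 + (- 1 / real (2 * h))) ^ Suc k"
      using h by (intro Bernoulli_inequality) (simp add: field_simps)
    also have "\<dots> = q * q ^ k" by (simp add: q_def)
    also have "\<dots> \<le> y a * q ^ k" using ya q by (intro mult_right_mono) auto
    finally show "1 / 2 \<le> y (a + k)" by (simp add: y_def power_add mult_ac)
    have "y (a + k) = y a * q ^ k" by (simp add: y_def power_add)
    also have "\<dots> \<le> 1 * 1" using a q by (intro mult_mono power_le_one) auto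
    finally show "y (a + k) \<le> 1" by simp
  qed
  have ypos: "y j > 0" for j using x q by (simp add: y_def)
  have le1: "1 - y j * exp (- y j) \<le> 1" for j using ypos[of j] by simp
  have fac: "1 - y j * exp (- y j) \<le> exp (- 1 / 6)" if j: "j \<in> {a..<a + h}" for j
  proof -
    obtain k where k: "j = a + k" "k < h" using j by (metis add_less_cancel_left atLeastLessThan_iff le_Suc_ex)
    have "exp (- 1) \<le> exp (- y j)" using win(2)[OF k(2)] k by simp
    moreover have "(1/3::real) \<le> exp (- 1)" using exp_le by (simp add: exp_minus field_simps)
    ultimately have "1 / 3 \<le> exp (- y j)" by linarith
    then have "1 / 2 * (1 / 3) \<le> y j * exp (- y j)"
      using win(1)[OF k(2)] k by (intro mult_mono) auto
    then have "1 - y j * exp (- y j) \<le> 1 + (- 1 / 6)" by simp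
    also have "\<dots> \<le> exp (- 1 / 6)" by (rule exp_ge_add_one_self)
    finally show ?thesis .
  qed
  have "(\<Prod>j<J + h. 1 - y j * exp (- y j)) =
    (\<Prod>j\<in>{a..<a + h}. 1 - y j * exp (- y j)) * (\<Prod>j\<in>{..<J + h} - {a..<a + h}. 1 - y j * exp (- y j))"
    using aJ by (subst mult.commute, intro prod.subset_diff) auto
  also have "\<dots> \<le> (\<Prod>j\<in>{a..<a + h}. exp (- 1 / 6)) * 1"
    by (intro mult_mono prod_mono prod_le_1 conjI prod_nonneg fac ballI one_minus_mult_exp_nonneg le1) auto
  also have "\<dots> = exp (real h * (- 1 / 6))" by (simp only: exp_of_nat_mult prod_constant card_atLeastLessThan) simp
  finally show ?thesis by (simp add: y_def q_def)
qed

text \<open>Color \<open>m\<close> stands for the class chosen first; the color \<open>0\<close> is left over for the points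
  in no class.\<close>

lemma unique_coloring_of_miss_prob:
  fixes e :: "'b \<Rightarrow> 'a set"
  assumes "finite V" "finite F" "\<And>a. a \<in> F \<Longrightarrow> e a \<subseteq> V" "0 < p" "p < 1"
    and "(\<Sum>a\<in>F. miss_prob p m (card (e a))) < 1"
  shows "\<exists>c :: 'a \<Rightarrow> nat. range c \<subseteq> {..m} \<and> (\<forall>a\<in>F. \<exists>y\<in>e a. \<forall>z\<in>e a - {y}. c y \<noteq> c z)"
  using assms
proof (induction m arbitrary: F e)
  case 0
  then have "F = {}" by simp
  then show ?case by (intro exI[of _ "\<lambda>_. 0"]) auto
next
  case (Suc m)
  note V = Suc.prems(1) and F = Suc.prems(2) and eV = Suc.prems(3) and p = Suc.prems(4,5)
  \<comment> \<open>Meeting a set in exactly one point serves it for good, so its remaining risk is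
    then 0. Averaging \<open>g\<close> over the random class gives back the recursion of
    \<open>miss_prob\<close>.\<close>
  define g where "g s k = (if k = 1 then 0 else miss_prob p m (s - k))" for s k :: nat
  have "bexp (\<lambda>_. p) V (\<lambda>A. g (card (e a)) (card (A \<inter> e a))) = miss_prob p (Suc m) (card (e a))"
    if a: "a \<in> F" for a
  proof -
    have fin: "finite (e a)" using eV[OF a] V finite_subset by blast
    have "bexp (\<lambda>_. p) V (\<lambda>A. g (card (e a)) (card (A \<inter> e a))) = bexp (\<lambda>_. p) (e a) (\<lambda>A. g (card (e a)) (card A))"
      using V eV[OF a] by (rule bexp_restrict)
    also have "\<dots> = (\<Sum>k\<le>card (e a). real (card (e a) choose k) * p ^ k * (1 - p) ^ (card (e a) - k) * g (card (e a)) k)"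
      by (rule bexp_card[OF fin])
    also have "\<dots> = miss_prob p (Suc m) (card (e a))"
      unfolding miss_prob.simps g_def by (intro sum.mono_neutral_cong_right) auto
    finally show ?thesis .
  qed
  then have "bexp (\<lambda>_. p) V (\<lambda>A. \<Sum>a\<in>F. g (card (e a)) (card (A \<inter> e a))) < 1"
    unfolding bexp_sum using Suc.prems(6) by simp
  then obtain A where A: "A \<subseteq> V" "(\<Sum>a\<in>F. g (card (e a)) (card (A \<inter> e a))) < 1"
    using exists_le_bexp[OF V, of "\<lambda>_. p"] p by force
  \<comment> \<open>Only the unserved sets are passed on, with the class \<open>A\<close> removed
    from them; their remaining risks still sum to less than 1.\<close>
  define F' where "F' = {a\<in>F. card (A \<inter> e a) \<noteq> 1}"
  have "(\<Sum>a\<in>F'. miss_prob p m (card (e a - A))) = (\<Sum>a\<in>F. g (card (e a)) (card (A \<inter> e a)))"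
  proof (intro sum.mono_neutral_cong_left ballI)
    fix a assume a: "a \<in> F'"
    then have "finite (e a)" using eV[of a] V finite_subset by (auto simp: F'_def)
    then have "card (e a - A) = card (e a) - card (A \<inter> e a)"
      by (metis Int_commute card_Diff_subset_Int finite_Int)
    then show "miss_prob p m (card (e a - A)) = g (card (e a)) (card (A \<inter> e a))"
      using a by (simp add: F'_def g_def)
  qed (use F in \<open>auto simp: F'_def g_def\<close>)
  with A have "(\<Sum>a\<in>F'. miss_prob p m (card (e a - A))) < 1" by simp
  then obtain c :: "'a \<Rightarrow> nat" where c: "range c \<subseteq> {..m}"
    "\<And>a. a \<in> F' \<Longrightarrow> \<exists>y\<in>e a - A. \<forall>z\<in>e a - A - {y}. c y \<noteq> c z"
    using Suc.IH[of F' "\<lambda>a. e a - A"] V F eV p by (fastforce simp: F'_def)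
  \<comment> \<open>The color \<open>Suc m\<close> is new, so it cannot spoil a uniqueness achieved
    by \<open>c\<close> outside \<open>A\<close>.\<close>
  define d where "d v = (if v \<in> A then Suc m else c v)" for v
  have cle: "c v \<noteq> Suc m" for v using c(1) by (metis atMost_iff not_less_eq_eq order_refl rangeI subsetD)
  have "\<exists>y\<in>e a. \<forall>z\<in>e a - {y}. d y \<noteq> d z" if a: "a \<in> F" for a
  proof (cases "a \<in> F'")
    case True
    then obtain y where y: "y \<in> e a - A" "\<forall>z\<in>e a - A - {y}. c y \<noteq> c z" using c(2) by blast
    then show ?thesis using cle by (intro bexI[of _ y]) (auto simp: d_def)
  next
    case False
    then have "card (A \<inter> e a) = 1" using a by (simp add: F'_def)
    then obtain y where y: "A \<inter> e a = {y}" by (auto simp: card_1_singleton_iff)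
    then have "y \<in> A" "y \<in> e a" "\<And>z. z \<in> e a - {y} \<Longrightarrow> z \<notin> A" by auto
    then show ?thesis using cle by (intro bexI[of _ y]) (auto simp: d_def not_sym)
  qed
  moreover have "range d \<subseteq> {..Suc m}" using c(1) by (auto simp: d_def image_subset_iff le_SucI)
  ultimately show ?case by blast
qed

text \<open>Peel off vertices with fewer than \<open>L\<close> remaining neighbors and color them
  greedily in reverse order: at its turn, a vertex sees fewer than \<open>L\<close> colored
  neighbors and has a free color. What cannot be peeled has minimum degree at least
  \<open>L\<close>.\<close>

lemma degenerate_part:
  assumes "finite W" "sym R" "L \<ge> 1"
  shows "\<exists>S\<subseteq>W. \<exists>g. range g \<subseteq> {..<L} \<and> (\<forall>x\<in>S. \<forall>y\<in>S. (x, y) \<in> R \<and> x \<noteq> y \<longrightarrow> g x \<noteq> (g y :: nat)) \<and>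
    (\<forall>x\<in>W - S. L \<le> card {y\<in>W - S. (x, y) \<in> R})"
  using assms(1)
proof (induction W rule: finite_psubset_induct)
  case (psubset W)
  show ?case
  proof (cases "\<forall>x\<in>W. L \<le> card {y\<in>W. (x, y) \<in> R}")
    case True
    then show ?thesis using assms(3) by (intro exI[of _ "{}"]) (auto intro!: exI[of _ "\<lambda>_. 0"])
  next
    case False
    then obtain x where x: "x \<in> W" "card {y\<in>W. (x, y) \<in> R} < L" by force
    then have "W - {x} \<subset> W" by auto
    from psubset.IH[OF this] obtain S g where S: "S \<subseteq> W - {x}" "range g \<subseteq> {..<L}"
      "\<And>u v. u \<in> S \<Longrightarrow> v \<in> S \<Longrightarrow> (u, v) \<in> R \<Longrightarrow> u \<noteq> v \<Longrightarrow> g u \<noteq> (g v :: nat)"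
      "\<And>u. u \<in> W - {x} - S \<Longrightarrow> L \<le> card {y\<in>W - {x} - S. (u, y) \<in> R}" by blast
    have "card (g ` {y\<in>S. (x, y) \<in> R}) \<le> card {y\<in>S. (x, y) \<in> R}"
      using S(1) psubset.hyps by (intro card_image_le) (auto intro: finite_subset)
    also have "\<dots> \<le> card {y\<in>W. (x, y) \<in> R}"
      using S(1) psubset.hyps by (intro card_mono) auto
    also have "\<dots> < card {..<L}" using x by simp
    finally have less: "card (g ` {y\<in>S. (x, y) \<in> R}) < card {..<L}" .
    have "\<not> {..<L} \<subseteq> g ` {y\<in>S. (x, y) \<in> R}"
    proof -
      have "finite (g ` {y\<in>S. (x, y) \<in> R})"
        using S(1) psubset.hyps by (intro finite_imageI) (auto intro: finite_subset)
      then show ?thesis using card_mono[of "g ` {y\<in>S. (x, y) \<in> R}" "{..<L}"] less by auto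
    qed
    then obtain k where k: "k < L" "k \<notin> g ` {y\<in>S. (x, y) \<in> R}" by auto
    have eq: "W - insert x S = W - {x} - S" by auto
    have "g u \<noteq> k" if "u \<in> S" "(x, u) \<in> R \<or> (u, x) \<in> R" for u
      using k(2) that symD[OF assms(2)] by auto
    then have "\<forall>u\<in>insert x S. \<forall>v\<in>insert x S. (u, v) \<in> R \<and> u \<noteq> v \<longrightarrow> (g(x := k)) u \<noteq> (g(x := k)) v"
      using S(1,3) by auto
    moreover have "range (g(x := k)) \<subseteq> {..<L}" using S(2) k(1) by auto
    moreover have "insert x S \<subseteq> W" using S(1) x(1) by auto
    moreover have "\<forall>u\<in>W - insert x S. L \<le> card {y\<in>W - insert x S. (u, y) \<in> R}"
      unfolding eq using S(4) by blast
    ultimately show ?thesis by (intro exI[of _ "insert x S"] exI[of _ "g(x := k)"] conjI)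
  qed
qed

section \<open>Assembling the coloring and counting its colors\<close>

lemma chi_CF_leI:
  assumes "c ` pverts G \<subseteq> {..<r}" "conflict_free G (c :: 'a \<Rightarrow> nat)"
  shows "chi_CF G \<le> r"
  unfolding chi_CF_def using assms by (intro Least_le) blast

lemma pair_graph_finite: "pair_graph G \<Longrightarrow> finite (pverts G)"
  by (simp add: pair_graph_def pair_digraph_def pair_fin_digraph_def pair_fin_digraph_axioms_def)

lemma pair_graph_sym: "pair_graph G \<Longrightarrow> sym (parcs G)"
proof -
  assume "pair_graph G"
  then interpret pair_graph G .
  show "sym (parcs G)" using pair_sym_arcs by (simp add: symmetric_def)
qed

text \<open>The peeled part takes \<open>2 * h\<close> colors and the rest \<open>J + h + 1\<close>
  others. The hypothesis \<open>large\<close> makes the union bound over at most \<open>n\<close>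
  vertices work, and \<open>J\<close> lets the window be reached by every neighborhood of size at
  most \<open>n\<close>.\<close>

lemma chi_CF_upper:
  fixes G :: "'a pair_pre_digraph"
  assumes G: "pair_graph G" and n: "card (pverts G) = n" and h: "h \<ge> 1"
    and large: "exp 1 * real n * real n * exp (- real h / 6) < 1"
    and J: "real n * exp (- real J / real (2 * h)) \<le> 1"
  shows "chi_CF G \<le> 3 * h + J + 1"
proof -
  note fin = pair_graph_finite[OF G]
  define L where "L = 2 * h"
  have L: "L \<ge> 1" using h by (simp add: L_def)
  obtain S g where S: "S \<subseteq> pverts G" "range g \<subseteq> {..<L}"
    "\<And>x y. x \<in> S \<Longrightarrow> y \<in> S \<Longrightarrow> (x, y) \<in> parcs G \<Longrightarrow> x \<noteq> y \<Longrightarrow> g x \<noteq> (g y :: nat)"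
    "\<And>x. x \<in> pverts G - S \<Longrightarrow> L \<le> card {y\<in>pverts G - S. (x, y) \<in> parcs G}"
    using degenerate_part[OF fin pair_graph_sym[OF G] L] by blast
  define W where "W = pverts G - S"
  define e where "e x = closed_nbhd G x \<inter> W" for x
  have eW: "e x \<subseteq> W" for x by (simp add: e_def)
  have finW: "finite W" using fin by (simp add: W_def)
  have ce: "L \<le> card (e x)" "card (e x) \<le> n" if "x \<in> W" for x
  proof -
    have "L \<le> card {y\<in>W. (x, y) \<in> parcs G}" using S(4)[of x] that by (simp add: W_def)
    also have "\<dots> \<le> card (e x)"
      using finW by (intro card_mono) (auto simp: e_def closed_nbhd_def nbhd_def W_def)
    finally show "L \<le> card (e x)" .
    have "card (e x) \<le> card (pverts G)" using fin by (intro card_mono) (auto simp: e_def W_def)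
    then show "card (e x) \<le> n" using n by simp
  qed
  define p where "p = 1 / real L"
  have p: "0 < p" "p < 1" using h by (auto simp: p_def L_def)
  have "(\<Sum>x\<in>W. miss_prob p (J + h) (card (e x))) \<le> (\<Sum>x\<in>W. exp 1 * real n * exp (- real h / 6))"
  proof (rule sum_mono)
    fix x assume x: "x \<in> W"
    define s where "s = card (e x)"
    have s: "L \<le> s" "s \<le> n" using ce[OF x] by (auto simp: s_def)
    have s1: "s \<ge> 1" using s L by simp
    \<comment> \<open>The window lemma is applied with \<open>x = s / L\<close>, the mean number of
      points of the neighborhood in the first class; \<open>x \<ge> 1\<close> is the minimum degree
      condition.\<close>
    have y: "p * (1 - p) ^ j * real s = (real s / real L) * (1 - 1 / real (2 * h)) ^ j" for j
      by (simp add: p_def L_def)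
    have "real s / real L * exp (- real J / real (2 * h)) \<le> real n * exp (- real J / real (2 * h))"
    proof (rule mult_right_mono)
      show "real s / real L \<le> real n"
        using frac_le[of "real n" "real s" 1 "real L"] s L by simp
    qed simp
    with J have "real s / real L * exp (- real J / real (2 * h)) \<le> 1" by linarith
    then have "(\<Prod>j<J + h. 1 - p * (1 - p) ^ j * real s * exp (- (p * (1 - p) ^ j * real s))) \<le> exp (- real h / 6)"
      unfolding y using s L h by (intro prod_le_window) auto
    then have "miss_prob p (J + h) s \<le> fact s * exp (real s) / real s ^ s * exp (- real h / 6)"
      using s1 by (intro order_trans[OF miss_prob_le[OF p, of "real s"]] mult_left_mono) auto
    also have "\<dots> \<le> exp 1 * real n * exp (- real h / 6)"
    proof (intro mult_right_mono)
      have "fact s * exp (real s) / real s ^ s \<le> exp 1 * real s"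
        using fact_mult_exp_le[OF s1] s1 by (simp add: pos_divide_le_eq)
      also have "\<dots> \<le> exp 1 * real n" using s by simp
      finally show "fact s * exp (real s) / real s ^ s \<le> exp 1 * real n" .
    qed auto
    finally show "miss_prob p (J + h) (card (e x)) \<le> exp 1 * real n * exp (- real h / 6)"
      by (simp add: s_def)
  qed
  also have "\<dots> = real (card W) * (exp 1 * real n * exp (- real h / 6))" by simp
  also have "\<dots> \<le> real n * (exp 1 * real n * exp (- real h / 6))"
    using card_mono[OF fin, of W] n by (intro mult_right_mono) (auto simp: W_def)
  also have "\<dots> < 1" using large by (simp add: mult_ac)
  finally have "(\<Sum>x\<in>W. miss_prob p (J + h) (card (e x))) < 1" .
  with finW finW eW p have "\<exists>c :: 'a \<Rightarrow> nat. range c \<subseteq> {..J + h} \<and> (\<forall>x\<in>W. \<exists>y\<in>e x. \<forall>z\<in>e x - {y}. c y \<noteq> c z)"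
    by (rule unique_coloring_of_miss_prob)
  then obtain c :: "'a \<Rightarrow> nat" where c: "range c \<subseteq> {..J + h}"
      "\<And>x. x \<in> W \<Longrightarrow> \<exists>y\<in>e x. \<forall>z\<in>e x - {y}. c y \<noteq> c z"
    by metis
  \<comment> \<open>The shift by \<open>L\<close> keeps the two palettes disjoint, so a color unique
    within its own part of a neighborhood is unique in all of it.\<close>
  define d where "d v = (if v \<in> S then g v else L + c v)" for v
  have gL: "g v < L" for v using S(2) by auto
  have "d ` pverts G \<subseteq> {..<3 * h + J + 1}"
  proof (rule image_subsetI)
    fix v
    have "c v \<le> J + h" "g v < L" using c(1) gL by auto
    then show "d v \<in> {..<3 * h + J + 1}" by (auto simp: d_def L_def)
  qed
  moreover have "conflict_free G d"
    unfolding conflict_free_def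
  proof
    fix x assume x: "x \<in> pverts G"
    show "\<exists>y\<in>closed_nbhd G x. \<forall>z\<in>closed_nbhd G x - {y}. d y \<noteq> d z"
    proof (cases "x \<in> S")
      case True
      have "d x \<noteq> d z" if z: "z \<in> closed_nbhd G x - {x}" for z
        using z True S(3)[of x z] gL[of x] by (auto simp: d_def closed_nbhd_def nbhd_def)
      then show ?thesis by (intro bexI[of _ x]) (auto simp: closed_nbhd_def)
    next
      case False
      then obtain y where y: "y \<in> e x" "\<forall>z\<in>e x - {y}. c y \<noteq> c z" using c(2)[of x] x by (auto simp: W_def)
      have "d y \<noteq> d z" if z: "z \<in> closed_nbhd G x - {y}" for z
      proof (cases "z \<in> S")
        case True
        then show ?thesis using y(1) gL[of z] by (auto simp: d_def e_def W_def)
      next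
        case False
        then have "z \<in> e x - {y}" using z closed_nbhd_subset[OF x] by (auto simp: e_def W_def)
        then show ?thesis using y False by (auto simp: d_def e_def W_def)
      qed
      then show ?thesis using y(1) by (intro bexI[of _ y]) (auto simp: e_def)
    qed
  qed
  ultimately show ?thesis by (rule chi_CF_leI)
qed

lemma max_chi_CF_upper:
  assumes n: "n \<ge> 3"
  shows "real (max_chi_CF n) \<le> 102 * (ln (real n))\<^sup>2"
proof -
  \<comment> \<open>The 12 cancels the two factors \<open>n\<close> in the union bound, and
    \<open>7 > 6\<close> absorbs the factor \<open>exp 1\<close>. Then \<open>J\<close> is just
    large enough for \<open>n * exp (- J / (2 * h)) \<le> 1\<close>.\<close>
  define h where "h = nat \<lceil>12 * ln (real n)\<rceil> + 7"
  define J where "J = nat \<lceil>2 * real h * ln (real n)\<rceil>"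
  have "exp 1 \<le> real n" using exp_le n by linarith
  then have ln1: "ln (real n) \<ge> 1" using n by (subst ln_ge_iff) auto
  have h: "real h \<ge> 12 * ln (real n) + 7" "real h \<le> 12 * ln (real n) + 8"
    unfolding h_def using ln1 by linarith+
  have J: "real J \<ge> 2 * real h * ln (real n)" "real J \<le> 2 * real h * ln (real n) + 1"
    unfolding J_def using ln1 by (simp_all add: real_nat_ceiling_ge)
  have "exp 1 * real n * real n * exp (- real h / 6) =
      exp 1 * exp (ln (real n)) * exp (ln (real n)) * exp (- real h / 6)"
    using n by simp
  also have "\<dots> = exp (1 + 2 * ln (real n) - real h / 6)"
    unfolding mult_exp_exp by (intro arg_cong[where f = exp]) simp
  also have "\<dots> < 1" using h by simp
  finally have 1: "exp 1 * real n * real n * exp (- real h / 6) < 1" .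
  have "real n * exp (- real J / real (2 * h)) = exp (ln (real n) - real J / real (2 * h))"
    using n by (simp add: exp_diff exp_minus field_simps)
  also have "\<dots> \<le> 1" using J h ln1 by (simp add: field_simps)
  finally have 2: "real n * exp (- real J / real (2 * h)) \<le> 1" .
  have "chi_CF G \<le> 3 * h + J + 1" if "pair_graph G" "card (pverts G) = n" for G :: "nat pair_pre_digraph"
    using that _ 1 2 by (rule chi_CF_upper) (simp add: h_def)
  then have "max_chi_CF n \<le> 3 * h + J + 1"
    unfolding max_chi_CF_def
    by (intro Max.boundedI finite_chi_CF_values chi_CF_values_nonempty) blast
  then have "real (max_chi_CF n) \<le> 3 * real h + real J + 1" by linarith
  also have "\<dots> \<le> 3 * real h + 2 * real h * ln (real n) + 2" using J by simp
  \<comment> \<open>Since \<open>ln n \<ge> 1\<close>,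
    \<open>h \<le> 12 * ln n + 8 \<le> 20 * ln n\<close>; the total is
    \<open>60 + 40 + 2 = 102\<close>.\<close>
  also have "\<dots> \<le> 3 * (20 * ln (real n)) + 2 * (20 * ln (real n)) * ln (real n) + 2"
    using h ln1 by (intro add_mono mult_mono) auto
  also have "\<dots> \<le> 60 * (ln (real n))\<^sup>2 + 40 * (ln (real n))\<^sup>2 + 2 * (ln (real n))\<^sup>2"
    using ln1 self_le_power[of "ln (real n)" 2] power_mono[of 1 "ln (real n)" 2]
    by (intro add_mono) (auto simp: power2_eq_square)
  finally show ?thesis by simp
qed

section \<open>The lower bound\<close>

lemma bexp_of_bool_empty:
  assumes "finite J"
  shows "bexp p J (\<lambda>E. of_bool (E = {})) = (\<Prod>i\<in>J. 1 - p i)"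
  using assms
proof (induction J rule: finite_induct)
  case (insert a J)
  then show ?case by (simp add: bexp_insert)
qed simp

lemma prod_one_minus_le_exp:
  assumes "finite J" "\<And>i. i \<in> J \<Longrightarrow> 0 \<le> p i \<and> p i \<le> 1"
  shows "(\<Prod>i\<in>J. 1 - p i :: real) \<le> exp (- (\<Sum>i\<in>J. p i))"
proof -
  have "(\<Prod>i\<in>J. 1 - p i) \<le> (\<Prod>i\<in>J. exp (- p i))"
  proof (rule prod_mono)
    fix i assume "i \<in> J"
    then show "0 \<le> 1 - p i \<and> 1 - p i \<le> exp (- p i)"
      using assms(2)[of i] exp_ge_add_one_self[of "- p i"] by simp
  qed
  also have "\<dots> = exp (- (\<Sum>i\<in>J. p i))" using assms by (simp add: exp_sum sum_negf[symmetric])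
  finally show ?thesis .
qed

text \<open>The exact probability is the product of all \<open>1 - p i\<close> times the sum of
  \<open>p i / (1 - p i)\<close>, and \<open>1 / (1 - p i) \<le> 4 / 3\<close>.\<close>

lemma bexp_card_eq_1_le:
  assumes "finite J" "\<And>i. i \<in> J \<Longrightarrow> 0 \<le> p i \<and> p i \<le> 1 / 4"
  shows "bexp p J (\<lambda>E. of_bool (card E = 1)) \<le> 4 / 3 * (\<Sum>i\<in>J. p i) * exp (- (\<Sum>i\<in>J. p i))"
proof -
  have "bexp p J (\<lambda>E. of_bool (card E = 1)) \<le> 4 / 3 * (\<Sum>i\<in>J. p i) * (\<Prod>i\<in>J. 1 - p i)"
    using assms
  proof (induction J rule: finite_induct)
    case (insert a J)
    define P where "P = (\<Prod>i\<in>J. 1 - p i)"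
    define m where "m = (\<Sum>i\<in>J. p i)"
    have pa: "0 \<le> p a" "p a \<le> 1 / 4" "p a \<le> 1" using insert.prems[of a] by auto
    have IH: "bexp p J (\<lambda>E. of_bool (card E = 1)) \<le> 4 / 3 * m * P"
      unfolding m_def P_def using insert.prems by (intro insert.IH) auto
    have P0: "P \<ge> 0" unfolding P_def using insert.prems by (intro prod_nonneg) fastforce
    have "bexp p J (\<lambda>E. of_bool (card (insert a E) = 1)) = bexp p J (\<lambda>E. of_bool (E = {}))"
    proof (rule bexp_cong)
      fix E assume "E \<subseteq> J"
      then have "finite E" "a \<notin> E" using insert.hyps by (auto intro: finite_subset)
      then show "of_bool (card (insert a E) = 1) = of_bool (E = {})" by simp
    qed
    also have "\<dots> = P" unfolding P_def using insert.hyps(1) by (rule bexp_of_bool_empty)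
    finally have "bexp p (insert a J) (\<lambda>E. of_bool (card E = 1)) =
        p a * P + (1 - p a) * bexp p J (\<lambda>E. of_bool (card E = 1))"
      using insert.hyps by (simp add: bexp_insert)
    also have "\<dots> \<le> (4 / 3 * (1 - p a) * p a) * P + (1 - p a) * (4 / 3 * m * P)"
    proof (intro add_mono mult_left_mono mult_right_mono)
      have "1 * p a \<le> (4 / 3 * (1 - p a)) * p a" using pa by (intro mult_right_mono) auto
      then show "p a \<le> 4 / 3 * (1 - p a) * p a" by simp
    qed (use pa P0 IH in auto)
    also have "\<dots> = 4 / 3 * (p a + m) * ((1 - p a) * P)" by (simp add: field_simps)
    finally show ?case using insert.hyps by (simp add: P_def m_def)
  qed simp
  also have "\<dots> \<le> 4 / 3 * (\<Sum>i\<in>J. p i) * exp (- (\<Sum>i\<in>J. p i))"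
  proof (rule mult_left_mono)
    have "0 \<le> p i \<and> p i \<le> 1" if "i \<in> J" for i using assms(2)[OF that] by linarith
    then show "(\<Prod>i\<in>J. 1 - p i) \<le> exp (- (\<Sum>i\<in>J. p i))"
      using assms(1) by (rule prod_one_minus_le_exp[rotated])
    show "0 \<le> 4 / 3 * (\<Sum>i\<in>J. p i)" using assms(2) by (simp add: sum_nonneg)
  qed
  finally show ?thesis .
qed

text \<open>Either no element or exactly one; half of the exponent absorbs the linear factor
  \<open>1 + 4 / 3 * \<mu>\<close>.\<close>

lemma bexp_card_le_1:
  assumes "finite J" "\<And>i. i \<in> J \<Longrightarrow> 0 \<le> p i \<and> p i \<le> 1 / 4" "m \<le> (\<Sum>i\<in>J. p i)"
  shows "bexp p J (\<lambda>E. of_bool (card E \<le> 1)) \<le> 3 * exp (- m / 2)"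
proof -
  define \<mu> where "\<mu> = (\<Sum>i\<in>J. p i)"
  have p1: "\<And>i. i \<in> J \<Longrightarrow> 0 \<le> p i \<and> p i \<le> 1" using assms(2) by fastforce
  have "bexp p J (\<lambda>E. of_bool (card E \<le> 1)) = bexp p J (\<lambda>E. of_bool (E = {}) + of_bool (card E = 1))"
  proof (rule bexp_cong)
    fix E assume "E \<subseteq> J"
    then have "finite E" using assms(1) finite_subset by blast
    then show "of_bool (card E \<le> 1) = (of_bool (E = {}) + of_bool (card E = 1) :: real)"
      by (cases "card E") auto
  qed
  also have "\<dots> \<le> exp (- \<mu>) + 4 / 3 * \<mu> * exp (- \<mu>)"
    unfolding bexp_add \<mu>_def
    using bexp_card_eq_1_le[OF assms(1,2)] bexp_of_bool_empty[OF assms(1), of p] prod_one_minus_le_exp[OF assms(1) p1]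
    by (intro add_mono) auto
  also have "\<dots> = (1 + 4 / 3 * \<mu>) * exp (- \<mu>)" by (simp add: algebra_simps)
  also have "\<dots> \<le> (3 * exp (\<mu> / 2)) * exp (- \<mu>)"
  proof (rule mult_right_mono)
    have "\<mu> \<ge> 0" unfolding \<mu>_def using assms(2) by (intro sum_nonneg) auto
    then show "1 + 4 / 3 * \<mu> \<le> 3 * exp (\<mu> / 2)" using exp_ge_add_one_self[of "\<mu> / 2"] by linarith
  qed simp
  also have "\<dots> = 3 * exp (- \<mu> / 2)" by (simp add: exp_add[symmetric])
  also have "\<dots> \<le> 3 * exp (- m / 2)" using assms(3) by (simp add: \<mu>_def)
  finally show ?thesis .
qed

lemma exp_le_one_minus:
  fixes t :: real
  assumes "0 \<le> t" "t \<le> 1 / 2"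
  shows "exp (- 2 * t) \<le> 1 - t"
proof -
  have "- t - 2 * t\<^sup>2 \<le> ln (1 - t)" using assms by (intro ln_one_minus_pos_lower_bound) auto
  moreover have "t\<^sup>2 \<le> t * (1 / 2)" unfolding power2_eq_square using assms by (intro mult_left_mono) auto
  ultimately have "- 2 * t \<le> ln (1 - t)" by linarith
  then have "exp (- 2 * t) \<le> exp (ln (1 - t))" by simp
  then show ?thesis using assms by simp
qed

text \<open>As \<open>y * exp (- y)\<close> is at most \<open>exp (- 1)\<close>, this amounts to
  \<open>exp 1 \<ge> 8 / 3\<close>. It keeps the probabilities of a unique neighbor below 1/2, where
  \<open>exp_le_one_minus\<close> applies.\<close>

lemma mult_exp_minus_le: "4 / 3 * (y * exp (- y)) \<le> (1 / 2 :: real)"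
proof -
  have "(1 + 1 / 4 + (1 / 4)\<^sup>2 / 2 :: real) \<le> exp (1 / 4)" by (rule exp_lower_Taylor_quadratic) simp
  then have "(1 + 1 / 4 + (1 / 4)\<^sup>2 / 2 :: real) ^ 4 \<le> exp (1 / 4) ^ 4" by (intro power_mono) auto
  also have "exp (1 / 4) ^ 4 = exp (1 :: real)" by (simp flip: exp_of_nat_mult)
  finally have "(8 / 3 :: real) \<le> exp 1" by (simp add: power_numeral_reduce)
  then have "8 / 3 * y \<le> exp y" if "y \<ge> 0"
  proof -
    have "y \<le> exp (y - 1)" using exp_ge_add_one_self[of "y - 1"] by simp
    then have "8 / 3 * y \<le> exp 1 * exp (y - 1)" using that \<open>8 / 3 \<le> exp 1\<close> by (intro mult_mono) auto
    then show ?thesis by (simp add: exp_add[symmetric])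
  qed
  then have "8 / 3 * y \<le> exp y" using exp_gt_zero[of y] by (cases "y \<ge> 0") linarith+
  then show ?thesis by (simp add: exp_minus field_simps)
qed

text \<open>Each term is at most twice the increment of \<open>exp (- w / 2 ^ i)\<close>, so the sum telescopes.\<close>

lemma sum_halving_le: "(\<Sum>i<l. w * (1 / 2) ^ Suc i * exp (- (w * (1 / 2) ^ Suc i))) \<le> (2 :: real)"
  if w: "w \<ge> 0"
proof -
  define f where "f i = exp (- (w * (1 / 2) ^ i))" for i :: nat
  have "w * (1 / 2) ^ Suc i * exp (- (w * (1 / 2) ^ Suc i)) \<le> 2 * (f (Suc (Suc i)) - f (Suc i))" for i
  proof -
    define y where "y = w * (1 / 2) ^ Suc i"
    have "y / 2 \<le> exp (y / 2) - 1" using exp_ge_add_one_self[of "y / 2"] by linarith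
    then have "exp (- y) * (y / 2) \<le> exp (- y) * (exp (y / 2) - 1)" by (rule mult_left_mono) simp
    also have "\<dots> = exp (- (y / 2)) - exp (- y)"
      by (simp add: right_diff_distrib exp_add[symmetric])
    finally show ?thesis by (simp add: f_def y_def field_simps)
  qed
  then have "(\<Sum>i<l. w * (1 / 2) ^ Suc i * exp (- (w * (1 / 2) ^ Suc i)))
      \<le> (\<Sum>i<l. 2 * (f (Suc (Suc i)) - f (Suc i)))" by (rule sum_mono)
  also have "\<dots> = 2 * (\<Sum>i<l. f (Suc (Suc i)) - f (Suc i))" by (simp add: sum_distrib_left)
  also have "(\<Sum>i<l. f (Suc (Suc i)) - f (Suc i)) = f (Suc l) - f (Suc 0)"
    by (rule sum_lessThan_telescope)
  also have "2 * (f (Suc l) - f (Suc 0)) \<le> 2"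
  proof -
    have "f (Suc l) \<le> 1" using w by (simp add: f_def)
    moreover have "f (Suc 0) > 0" by (simp add: f_def)
    ultimately have "f (Suc l) - f (Suc 0) \<le> 1" by simp
    then show ?thesis by simp
  qed
  finally show ?thesis .
qed

text \<open>Averaging over the levels: each class contributes at most 2 in total over all
  \<open>l\<close> levels, so some level gets at most \<open>2 * r / l\<close> from all
  classes.\<close>

lemma exists_scale:
  fixes w :: "nat \<Rightarrow> real"
  assumes "l \<ge> 1" "\<And>j. j < r \<Longrightarrow> w j \<ge> 0"
  shows "\<exists>i<l. (\<Sum>j<r. w j * (1 / 2) ^ Suc i * exp (- (w j * (1 / 2) ^ Suc i))) \<le> 2 * real r / real l"
proof (rule ccontr)
  assume "\<not> ?thesis"
  then have "(\<Sum>i<l. 2 * real r / real l) < (\<Sum>i<l. \<Sum>j<r. w j * (1 / 2) ^ Suc i * exp (- (w j * (1 / 2) ^ Suc i)))"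
    using assms(1) by (intro sum_strict_mono) (auto simp: not_le lessThan_empty_iff)
  also have "\<dots> = (\<Sum>j<r. \<Sum>i<l. w j * (1 / 2) ^ Suc i * exp (- (w j * (1 / 2) ^ Suc i)))"
    by (rule sum.swap)
  also have "\<dots> \<le> (\<Sum>j<r. 2)" using assms(2) by (intro sum_mono sum_halving_le) auto
  finally show False using assms(1) by simp
qed

section \<open>Random graphs as random sets of unordered pairs\<close>

definition star :: "'a \<Rightarrow> 'a set \<Rightarrow> 'a set set" where
  "star x T = (\<lambda>y. {x, y}) ` T"

text \<open>With edges as two-element sets, each potential edge is one independent coordinate of the
  random subset.\<close>

definition all_edges :: "'a set \<Rightarrow> 'a set set" where
  "all_edges V = {e. \<exists>u\<in>V. \<exists>v\<in>V. u \<noteq> v \<and> e = {u, v}}"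

lemma finite_all_edges: "finite V \<Longrightarrow> finite (all_edges V)"
  by (rule finite_subset[of _ "Pow V"]) (auto simp: all_edges_def)

lemma inj_on_star: "inj_on (\<lambda>y. {x, y}) T"
  by (auto simp: inj_on_def doubleton_eq_iff)

lemma sum_star: "(\<Sum>e\<in>star x T. f e) = (\<Sum>y\<in>T. f {x, y})"
  unfolding star_def by (simp add: sum.reindex[OF inj_on_star])

lemma card_Int_star: "card {y\<in>C. {x, y} \<in> E} = card (E \<inter> star x C)"
proof -
  have "E \<inter> star x C = (\<lambda>y. {x, y}) ` {y\<in>C. {x, y} \<in> E}" by (auto simp: star_def)
  then show ?thesis by (simp add: card_image inj_on_star)
qed

lemma star_subset: "x \<in> V \<Longrightarrow> T \<subseteq> V \<Longrightarrow> x \<notin> T \<Longrightarrow> star x T \<subseteq> all_edges V"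
proof
  fix e assume V: "x \<in> V" "T \<subseteq> V" "x \<notin> T" and "e \<in> star x T"
  then obtain y where "y \<in> T" "e = {x, y}" unfolding star_def by blast
  with V show "e \<in> all_edges V"
    unfolding all_edges_def by (intro CollectI bexI[of _ x] bexI[of _ y]) auto
qed

text \<open>The stars from different centers in \<open>X\<close> to a set \<open>T\<close> disjoint
  from \<open>X\<close> share no edge, so events at different centers are independent.\<close>

lemma bexp_ball_star:
  assumes "finite V" "X \<subseteq> V" "T \<subseteq> V" "X \<inter> T = {}"
  shows "bexp p (all_edges V) (\<lambda>E. of_bool (\<forall>x\<in>X. P x (E \<inter> star x T))) =
    (\<Prod>x\<in>X. bexp p (star x T) (\<lambda>E. of_bool (P x E)))"
proof -
  have finX: "finite X" using assms finite_subset by blast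
  have eq: "of_bool (\<forall>x\<in>X. Q x) = (\<Prod>x\<in>X. of_bool (Q x) :: real)" for Q
    using finX by (induction X rule: finite_induct) auto
  have "disjoint_family_on (\<lambda>x. star x T) X"
    using assms(4) by (auto simp: disjoint_family_on_def star_def doubleton_eq_iff)
  then show ?thesis unfolding eq using assms finX
    by (intro bexp_UN_prod finite_all_edges star_subset) auto
qed

lemma bexp_of_bool_nonneg:
  assumes "finite I" "\<And>i. i \<in> I \<Longrightarrow> 0 \<le> p i \<and> p i \<le> 1"
  shows "0 \<le> bexp p I (\<lambda>E. of_bool (P E))"
proof -
  have "bexp p I (\<lambda>_. 0) \<le> bexp p I (\<lambda>E. of_bool (P E))" by (rule bexp_mono[OF assms(2)]) auto
  then show ?thesis using assms(1) by simp
qed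

lemma bexp_few_neighbors:
  assumes "finite V" "X \<subseteq> V" "D \<subseteq> V" "X \<inter> D = {}"
    and p: "\<And>e. e \<in> all_edges V \<Longrightarrow> 0 \<le> p e \<and> p e \<le> 1 / 4"
    and m: "\<And>x. x \<in> X \<Longrightarrow> m \<le> (\<Sum>y\<in>D. p {x, y})"
  shows "bexp p (all_edges V) (\<lambda>E. of_bool (\<forall>x\<in>X. card {y\<in>D. {x, y} \<in> E} \<le> 1)) \<le> (3 * exp (- m / 2)) ^ card X"
proof -
  have fin: "finite D" using assms finite_subset by blast
  have st: "star x D \<subseteq> all_edges V" if "x \<in> X" for x using that assms by (intro star_subset) auto
  have "bexp p (all_edges V) (\<lambda>E. of_bool (\<forall>x\<in>X. card {y\<in>D. {x, y} \<in> E} \<le> 1)) =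
    (\<Prod>x\<in>X. bexp p (star x D) (\<lambda>E. of_bool (card E \<le> 1)))"
    unfolding card_Int_star using assms(1-4) by (rule bexp_ball_star)
  also have "\<dots> \<le> (\<Prod>x\<in>X. 3 * exp (- m / 2))"
  proof (intro prod_mono conjI)
    fix x assume x: "x \<in> X"
    have p': "0 \<le> p e \<and> p e \<le> 1 / 4" if "e \<in> star x D" for e using p st[OF x] that by blast
    have f: "finite (star x D)" using fin by (simp add: star_def)
    show "bexp p (star x D) (\<lambda>E. of_bool (card E \<le> 1)) \<le> 3 * exp (- m / 2)"
      using m[OF x] p' f by (intro bexp_card_le_1) (auto simp: sum_star)
    show "0 \<le> bexp p (star x D) (\<lambda>E. of_bool (card E \<le> 1))"
      using p' f by (intro bexp_of_bool_nonneg) fastforce+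
  qed
  finally show ?thesis by simp
qed

text \<open>Disjoint classes have disjoint stars, so the probability is the product of
  \<open>1 - P j\<close>. Each factor is at least \<open>exp (- 2 * P j)\<close> with
  \<open>P j \<le> 4 / 3 * (\<mu> j * exp (- \<mu> j))\<close>, which gives the constant
  8/3.\<close>

lemma bexp_no_unique_class_ge:
  fixes C :: "nat \<Rightarrow> 'a set"
  assumes "finite T" "\<And>j. j < r \<Longrightarrow> C j \<subseteq> T" "disjoint_family_on C {..<r}"
    and p: "\<And>y. y \<in> T \<Longrightarrow> 0 \<le> p {x, y} \<and> p {x, y} \<le> 1 / 4"
    and \<mu>: "\<And>j. \<mu> j = (\<Sum>y\<in>C j. p {x, y})"
    and s: "(\<Sum>j<r. \<mu> j * exp (- \<mu> j)) \<le> s"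
  shows "exp (- (8 / 3 * s)) \<le> bexp p (star x T) (\<lambda>E. of_bool (\<forall>j<r. card (E \<inter> star x (C j)) \<noteq> 1))"
proof -
  define P where "P j = bexp p (star x (C j)) (\<lambda>E. of_bool (card E = 1))" for j
  have f: "finite (star x T)" using assms by (simp add: star_def)
  have p': "0 \<le> p e \<and> p e \<le> 1 / 4" if "e \<in> star x T" for e using p that by (auto simp: star_def)
  have sub: "star x (C j) \<subseteq> star x T" if "j < r" for j using assms(2)[OF that] by (auto simp: star_def)
  have fj: "finite (star x (C j))" if "j < r" for j using sub[OF that] f finite_subset by blast
  have P0: "0 \<le> P j" if "j < r" for j
    unfolding P_def using sub[OF that] p' fj[OF that] by (intro bexp_of_bool_nonneg) fastforce+
  have Ple: "P j \<le> 4 / 3 * (\<mu> j * exp (- \<mu> j))" if "j < r" for j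
    using bexp_card_eq_1_le[of "star x (C j)" p] sub[OF that] p' fj[OF that]
    by (auto simp: P_def \<mu> sum_star subset_eq mult_ac)
  have half: "P j \<le> 1 / 2" if "j < r" for j
    using Ple[OF that] mult_exp_minus_le[of "\<mu> j"] by linarith
  have dis: "disjoint_family_on (\<lambda>j. star x (C j)) {..<r}"
  proof -
    have "star x (C m) \<inter> star x (C n) = star x (C m \<inter> C n)" for m n
      unfolding star_def by (rule image_Int[symmetric]) (rule inj_on_star)
    then show ?thesis using assms(3) by (simp add: disjoint_family_on_def star_def)
  qed
  have "exp (- (8 / 3 * s)) \<le> exp (\<Sum>j<r. - 2 * P j)"
  proof -
    have "(\<Sum>j<r. 2 * P j) \<le> (\<Sum>j<r. 8 / 3 * (\<mu> j * exp (- \<mu> j)))"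
      using Ple by (intro sum_mono) fastforce
    also have "\<dots> = 8 / 3 * (\<Sum>j<r. \<mu> j * exp (- \<mu> j))" by (simp only: sum_distrib_left)
    also have "\<dots> \<le> 8 / 3 * s" using s by simp
    finally show ?thesis by (simp add: sum_negf)
  qed
  also have "\<dots> = (\<Prod>j<r. exp (- 2 * P j))" by (simp add: exp_sum)
  also have "\<dots> \<le> (\<Prod>j<r. 1 - P j)"
    using P0 half by (intro prod_mono conjI exp_le_one_minus) auto
  also have "\<dots> = (\<Prod>j<r. bexp p (star x (C j)) (\<lambda>E. of_bool (card E \<noteq> 1)))"
  proof (rule prod.cong)
    fix j assume "j \<in> {..<r}"
    then have "finite (star x (C j))" using fj by auto
    then have "P j + bexp p (star x (C j)) (\<lambda>E. of_bool (card E \<noteq> 1)) = 1"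
      unfolding P_def bexp_add[symmetric] by (simp add: of_bool_not_iff)
    then show "1 - P j = bexp p (star x (C j)) (\<lambda>E. of_bool (card E \<noteq> 1))" by simp
  qed simp
  also have "\<dots> = bexp p (star x T) (\<lambda>E. \<Prod>j<r. of_bool (card (E \<inter> star x (C j)) \<noteq> 1))"
    using sub dis f by (intro bexp_UN_prod[symmetric]) auto
  also have "(\<lambda>E. \<Prod>j<r. of_bool (card (E \<inter> star x (C j)) \<noteq> 1) :: real) =
     (\<lambda>E. of_bool (\<forall>j<r. card (E \<inter> star x (C j)) \<noteq> 1))"
  proof -
    have "(\<Prod>j<r. of_bool (Q j) :: real) = of_bool (\<forall>j<r. Q j)" for Q
      by (induction r) (auto simp: less_Suc_eq)
    then show ?thesis by simp
  qed
  finally show ?thesis .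
qed

text \<open>Each vertex of \<open>X\<close> independently sees no class exactly once with
  probability at least \<open>Q\<close>. The means \<open>\<mu> j\<close> must not depend on the
  vertex, so \<open>X\<close> will be taken from a single level.\<close>

lemma bexp_all_unique_class:
  fixes C :: "nat \<Rightarrow> 'a set"
  assumes "finite V" "X \<subseteq> V" "T \<subseteq> V" "X \<inter> T = {}"
    and C: "\<And>j. j < r \<Longrightarrow> C j \<subseteq> T" "disjoint_family_on C {..<r}"
    and p: "\<And>e. e \<in> all_edges V \<Longrightarrow> 0 \<le> p e \<and> p e \<le> 1 / 4"
    and \<mu>: "\<And>x j. x \<in> X \<Longrightarrow> \<mu> j = (\<Sum>y\<in>C j. p {x, y})"
    and s: "(\<Sum>j<r. \<mu> j * exp (- \<mu> j)) \<le> s"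
  shows "bexp p (all_edges V) (\<lambda>E. of_bool (\<forall>x\<in>X. \<exists>j<r. card {y\<in>C j. {x, y} \<in> E} = 1))
    \<le> exp (- exp (- (8 / 3 * s)) * real (card X))"
proof -
  define Q where "Q = exp (- (8 / 3 * s))"
  have fin: "finite T" "finite X" using assms finite_subset by blast+
  have st: "star x T \<subseteq> all_edges V" if "x \<in> X" for x using that assms by (intro star_subset) auto
  \<comment> \<open>The classes lie in \<open>T\<close>, so the event at \<open>x\<close> depends
    only on the star from \<open>x\<close> to \<open>T\<close>.\<close>
  have Int: "E \<inter> star x T \<inter> star x (C j) = E \<inter> star x (C j)" if "j < r" for E x j
    using C(1)[OF that] by (auto simp: star_def)
  have "bexp p (all_edges V) (\<lambda>E. of_bool (\<forall>x\<in>X. \<exists>j<r. card {y\<in>C j. {x, y} \<in> E} = 1)) =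
     bexp p (all_edges V) (\<lambda>E. of_bool (\<forall>x\<in>X. \<exists>j<r. card (E \<inter> star x T \<inter> star x (C j)) = 1))"
    unfolding card_Int_star by (intro bexp_cong) (simp add: Int cong: conj_cong)
  also have "\<dots> = (\<Prod>x\<in>X. bexp p (star x T) (\<lambda>E. of_bool (\<exists>j<r. card (E \<inter> star x (C j)) = 1)))"
    using assms(1-4) by (rule bexp_ball_star)
  also have "\<dots> \<le> (\<Prod>x\<in>X. exp (- Q))"
  proof (intro prod_mono conjI)
    fix x assume x: "x \<in> X"
    have f: "finite (star x T)" using fin by (simp add: star_def)
    have pT: "0 \<le> p {x, y} \<and> p {x, y} \<le> 1 / 4" if "y \<in> T" for y
      using p st[OF x] that by (auto simp: star_def)
    let ?b = "bexp p (star x T) (\<lambda>E. of_bool (\<exists>j<r. card (E \<inter> star x (C j)) = 1))"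
    have "?b + bexp p (star x T) (\<lambda>E. of_bool (\<forall>j<r. card (E \<inter> star x (C j)) \<noteq> 1))
       = bexp p (star x T) (\<lambda>_. 1)"
      unfolding bexp_add[symmetric] by (intro bexp_cong) auto
    also have "\<dots> = 1" using f by simp
    finally have "?b = 1 - bexp p (star x T) (\<lambda>E. of_bool (\<forall>j<r. card (E \<inter> star x (C j)) \<noteq> 1))" by simp
    also have "\<dots> \<le> 1 - Q"
      using bexp_no_unique_class_ge[OF fin(1) C pT \<mu>[OF x] s] by (simp add: Q_def)
    also have "\<dots> \<le> exp (- Q)" using exp_ge_add_one_self[of "- Q"] by simp
    finally show "?b \<le> exp (- Q)" .
    show "0 \<le> ?b"
      by (rule bexp_of_bool_nonneg[OF f]) (use pT in \<open>fastforce simp: star_def\<close>)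
  qed
  also have "\<dots> = exp (- Q * real (card X))" by (simp flip: exp_of_nat_mult)
  finally show ?thesis by (simp add: Q_def)
qed

section \<open>From pseudorandomness to the conflict-free chromatic number\<close>

lemma chi_CF_coloring:
  assumes "finite (pverts G)"
  obtains c :: "'a \<Rightarrow> nat" where "c ` pverts G \<subseteq> {..<chi_CF G}" "conflict_free G c"
proof -
  have "\<exists>r. \<exists>c :: 'a \<Rightarrow> nat. c ` pverts G \<subseteq> {..<r} \<and> conflict_free G c"
    using ex_conflict_free_coloring[OF assms] by (rule exI)
  then have "\<exists>c :: 'a \<Rightarrow> nat. c ` pverts G \<subseteq> {..<chi_CF G} \<and> conflict_free G c"
    unfolding chi_CF_def by (rule LeastI_ex)
  then show thesis using that by (elim exE conjE)
qed

definition graph_of :: "'a set \<Rightarrow> 'a set set \<Rightarrow> 'a pair_pre_digraph" where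
  "graph_of V E = \<lparr>pverts = V, parcs = {(x, y). x \<in> V \<and> y \<in> V \<and> {x, y} \<in> E}\<rparr>"

lemma pair_graph_graph_of:
  assumes "finite V" "E \<subseteq> all_edges V"
  shows "pair_graph (graph_of V E)"
proof unfold_locales
  show "symmetric (with_proj (graph_of V E))"
    by (auto simp: symmetric_def graph_of_def insert_commute intro!: symI)
  show "fst e \<noteq> snd e" if "e \<in> parcs (graph_of V E)" for e
    using that assms(2) by (auto simp: graph_of_def all_edges_def doubleton_eq_iff)
  show "finite (parcs (graph_of V E))"
    by (rule finite_subset[of _ "V \<times> V"]) (use assms in \<open>auto simp: graph_of_def\<close>)
qed (use assms in \<open>auto simp: graph_of_def\<close>)

text \<open>
  For a large color class, take \<open>K\<close> of its vertices together with the fewer than \<open>K\<close> vertices that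
  have at most one neighbor among these. These sets and the small classes all fit into a set \<open>T\<close> of
  \<open>2 r K\<close> vertices, and a vertex outside \<open>T\<close> can only be served by a small class. In \<open>B\<close>, the
  value \<open>r\<close> of \<open>f\<close> marks the vertices of \<open>T\<close> in large classes.
\<close>

lemma chi_CF_gt_of_pseudorandom:
  assumes V: "finite V" and E: "E \<subseteq> all_edges V" and K: "2 * r * K \<le> card V"
    and A: "\<And>D X. D \<subseteq> V \<Longrightarrow> X \<subseteq> V \<Longrightarrow> card D = K \<Longrightarrow> card X = K \<Longrightarrow> D \<inter> X = {} \<Longrightarrow>
       \<exists>x\<in>X. \<not> card {y\<in>D. {x, y} \<in> E} \<le> 1"
    and B: "\<And>T f. T \<subseteq> V \<Longrightarrow> card T = 2 * r * K \<Longrightarrow>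
       \<exists>x\<in>V - T. \<forall>j<r. card {y\<in>{y\<in>T. f y = j}. {x, y} \<in> E} \<noteq> 1"
  shows "r < chi_CF (graph_of V E)"
proof (rule ccontr)
  let ?G = "graph_of V E"
  assume "\<not> ?thesis"
  then have le: "chi_CF ?G \<le> r" by simp
  have pv: "pverts ?G = V" by (simp add: graph_of_def)
  obtain c :: "'a \<Rightarrow> nat" where c: "c ` V \<subseteq> {..<chi_CF ?G}" "conflict_free ?G c"
    using chi_CF_coloring[of ?G] V pv by metis
  have cr: "c v < r" if "v \<in> V" for v using c(1) le that by fastforce
  define C where "C j = {v\<in>V. c v = j}" for j
  have CV: "C j \<subseteq> V" for j by (auto simp: C_def)
  have "\<exists>D. \<not> card (C j) < K \<longrightarrow> D \<subseteq> C j \<and> card D = K" for j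
    using obtain_subset_with_card_n[of K "C j"] by (metis linorder_not_less)
  then obtain D where D: "\<And>j. \<not> card (C j) < K \<Longrightarrow> D j \<subseteq> C j \<and> card (D j) = K" by metis
  define X where "X j = {x\<in>V - D j. card {y\<in>D j. {x, y} \<in> E} \<le> 1}" for j
  have X: "card (X j) < K" if "\<not> card (C j) < K" for j
  proof (rule ccontr)
    assume "\<not> card (X j) < K"
    then obtain X' where X': "X' \<subseteq> X j" "card X' = K"
      using obtain_subset_with_card_n[of K "X j"] by (metis linorder_not_less)
    moreover have "D j \<subseteq> V" "card (D j) = K" using D[OF that] CV by auto
    moreover have "X' \<subseteq> V" "D j \<inter> X' = {}" using X' by (auto simp: X_def)
    ultimately obtain x where "x \<in> X'" "\<not> card {y\<in>D j. {x, y} \<in> E} \<le> 1" using A by blast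
    then show False using X' by (auto simp: X_def)
  qed
  \<comment> \<open>A small class enters whole; a large one is represented by \<open>D j\<close> and
    the exceptional vertices \<open>X j\<close>, which are fewer than \<open>K\<close> by
    \<open>A\<close>.\<close>
  define B' where "B' j = (if card (C j) < K then C j else D j \<union> X j)" for j
  have B'V: "B' j \<subseteq> V" for j using D[of j] CV[of j] by (auto simp: B'_def X_def)
  have B'c: "card (B' j) \<le> 2 * K" for j
  proof (cases "card (C j) < K")
    case False
    then show ?thesis
      using D[OF False] X[OF False] card_Un_le[of "D j" "X j"] by (simp add: B'_def)
  qed (simp add: B'_def)
  have "card (\<Union>j<r. B' j) \<le> (\<Sum>j<r. card (B' j))" by (rule card_UN_le) simp
  also have "\<dots> \<le> (\<Sum>j<r. 2 * K)" using B'c by (intro sum_mono) auto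
  also have "\<dots> = 2 * r * K" by simp
  finally obtain T where T: "(\<Union>j<r. B' j) \<subseteq> T" "T \<subseteq> V" "card T = 2 * r * K"
    using exists_subset_between[of "\<Union>j<r. B' j" "2 * r * K" V] B'V K V by blast
  define f where "f v = (if card (C (c v)) < K then c v else r)" for v
  obtain x where x: "x \<in> V" "x \<notin> T" "\<And>j. j < r \<Longrightarrow> card {y\<in>{y\<in>T. f y = j}. {x, y} \<in> E} \<noteq> 1"
    using B[OF T(2,3), of f] by blast
  have nb: "closed_nbhd ?G x = insert x {y\<in>V. {x, y} \<in> E}"
    using x by (auto simp: closed_nbhd_def nbhd_def graph_of_def)
  obtain y where y: "y \<in> closed_nbhd ?G x" "\<And>z. z \<in> closed_nbhd ?G x \<Longrightarrow> z \<noteq> y \<Longrightarrow> c y \<noteq> c z"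
    using c(2) x(1) unfolding conflict_free_def pv by blast
  have yV: "y \<in> V" using y(1) x by (auto simp: nb)
  \<comment> \<open>If the class of \<open>y\<close> is large, \<open>x\<close> has a second
    neighbor of this color in \<open>D j\<close>. If it is small, it lies in \<open>T\<close>, and
    \<open>y\<close> would be the only neighbor there with this color, against
    \<open>B\<close>.\<close>
  define j where "j = c y"
  have j: "j < r" using cr[OF yV] by (simp add: j_def)
  then have BT: "B' j \<subseteq> T" using T(1) by blast
  show False
  proof (cases "card (C j) < K")
    case True
    then have CT: "C j \<subseteq> T" using BT by (simp add: B'_def)
    have yC: "y \<in> C j" using yV by (simp add: C_def j_def)
    \<comment> \<open>Since \<open>x\<close> is outside \<open>T\<close> and \<open>C j\<close> is
      inside, \<open>y\<close> differs from \<open>x\<close> and is a genuine neighbor.\<close>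
    then have yx: "{x, y} \<in> E" using CT x(2) y(1) by (auto simp: nb)
    have "{y\<in>{y\<in>T. f y = j}. {x, y} \<in> E} = {y}"
    proof (intro equalityI subsetI)
      fix z assume z: "z \<in> {y\<in>{y\<in>T. f y = j}. {x, y} \<in> E}"
      then have "c z = j" using j by (auto simp: f_def split: if_splits)
      moreover have "z \<in> closed_nbhd ?G x" using z T(2) by (auto simp: nb)
      ultimately show "z \<in> {y}" using y(2)[of z] by (auto simp: j_def)
    qed (use yC yx CT True in \<open>auto simp: f_def j_def\<close>)
    then show False using x(3)[OF j] by simp
  next
    case False
    then have "x \<notin> D j" "x \<notin> X j" using BT x(2) by (auto simp: B'_def)
    then have "\<not> card {y\<in>D j. {x, y} \<in> E} \<le> 1" using x(1) by (simp add: X_def)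
    then have "\<not> {y\<in>D j. {x, y} \<in> E} \<subseteq> {y}" using card_mono[of "{y}"] by fastforce
    then obtain z where z: "z \<in> D j" "{x, z} \<in> E" "z \<noteq> y" by blast
    then have "z \<in> C j" using D[OF False] by blast
    then show False using y(2)[of z] z by (auto simp: C_def nb j_def)
  qed
qed

text \<open>Levels will be residues modulo \<open>l\<close>; the vertices \<open>i + l * t\<close>
  show that each level is large.\<close>

lemma card_residue_class_ge:
  assumes "i < l"
  shows "n div l \<le> card {v\<in>{..<n}. v mod l = i}"
proof -
  have eq: "card ((\<lambda>t. i + l * t) ` {..<n div l}) = n div l"
    using assms by (subst card_image) (auto simp: inj_on_def)
  have "(\<lambda>t. i + l * t) ` {..<n div l} \<subseteq> {v\<in>{..<n}. v mod l = i}"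
  proof (rule image_subsetI)
    fix t assume "t \<in> {..<n div l}"
    then have "l * Suc t \<le> l * (n div l)" by (intro mult_le_mono2) auto
    also have "\<dots> \<le> n" by simp
    finally show "i + l * t \<in> {v\<in>{..<n}. v mod l = i}" using assms by simp
  qed
  then have "card ((\<lambda>t. i + l * t) ` {..<n div l}) \<le> card {v\<in>{..<n}. v mod l = i}"
    by (rule card_mono[rotated]) simp
  then show ?thesis unfolding eq .
qed

text \<open>A union bound over two families of bad events, pairs \<open>(D, X)\<close> and labeled
  sets \<open>(T, f)\<close>; hypotheses \<open>a\<close> and \<open>b\<close> bound the expected
  number of each by 1/4.\<close>

lemma exists_pseudorandom:
  fixes n l r K :: nat
  defines "V \<equiv> {..<n}" and "M \<equiv> 2 * r * K"
  assumes l: "l \<ge> 1" and K: "K \<ge> 1" "M \<le> n"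
    and a: "(real n)\<^sup>2 * (3 * exp (- (real K / 4 ^ l) / 2)) \<le> 1 / 4"
    and b: "(real n * (real r + 1)) ^ M *
      exp (- exp (- (16 / 3 * (real r / real l))) * (real (n div l) - real M)) \<le> 1 / 4"
  obtains E where "E \<subseteq> all_edges V"
    "\<And>D X. D \<subseteq> V \<Longrightarrow> X \<subseteq> V \<Longrightarrow> card D = K \<Longrightarrow> card X = K \<Longrightarrow> D \<inter> X = {} \<Longrightarrow>
       \<exists>x\<in>X. \<not> card {y\<in>D. {x, y} \<in> E} \<le> 1"
    "\<And>T f. T \<subseteq> V \<Longrightarrow> card T = M \<Longrightarrow>
       \<exists>x\<in>V - T. \<forall>j<r. card {y\<in>{y\<in>T. f y = j}. {x, y} \<in> E} \<noteq> 1"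
proof -
  have V: "finite V" "card V = n" by (simp_all add: V_def)
  \<comment> \<open>The level of \<open>v\<close> is \<open>Suc (v mod l)\<close>, from 1 to
    \<open>l\<close>, so that edge probabilities never exceed 1/4.\<close>
  define q :: "nat \<Rightarrow> real" where "q v = (1 / 2) ^ Suc (v mod l)" for v
  define p where "p e = prod q e" for e
  have q: "0 \<le> q v" "q v \<le> 1 / 2" for v
    using power_le_one[of "1 / 2 :: real" "v mod l"] by (auto simp: q_def)
  have pxy: "p {x, y} = q x * q y" if "x \<noteq> y" for x y using that by (simp add: p_def)
  have p: "0 \<le> p e \<and> p e \<le> 1 / 4" if e: "e \<in> all_edges V" for e
  proof -
    obtain x y where "x \<noteq> y" "e = {x, y}" using e by (auto simp: all_edges_def)
    then show ?thesis using pxy[of x y] q[of x] q[of y] mult_mono[of "q x" "1/2" "q y" "1/2"] by simp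
  qed
  then have p1: "0 \<le> p e \<and> p e \<le> 1" if "e \<in> all_edges V" for e using that by fastforce
  define \<beta> where "\<beta> = 3 * exp (- (real K / 4 ^ l) / 2)"
  define P where "P = {D. D \<subseteq> V \<and> card D = K}"
  define PA where "PA = {(D, X) \<in> P \<times> P. D \<inter> X = {}}"
  have cP: "real (card P) \<le> real n ^ K"
  proof -
    have "K \<le> n \<Longrightarrow> n choose K \<le> n ^ K" by (rule binomial_le_pow)
    moreover have "\<not> K \<le> n \<Longrightarrow> n choose K \<le> n ^ K" by (simp add: binomial_eq_0)
    ultimately show ?thesis using n_subsets[OF V(1), of K] V(2)
      by (metis P_def of_nat_le_iff of_nat_power)
  qed
  have finP: "finite P" using V by (simp add: P_def)
  have fPA: "finite PA" by (rule finite_subset[of _ "P \<times> P"]) (use finP in \<open>auto simp: PA_def\<close>)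
  define evA where "evA = (\<lambda>(D :: nat set, X) E. of_bool (\<forall>x\<in>X. card {y\<in>D. {x, y} \<in> E} \<le> 1) :: real)"
  have \<beta>0: "\<beta> \<ge> 0" by (simp add: \<beta>_def)
  have "(\<Sum>DX\<in>PA. bexp p (all_edges V) (evA DX)) \<le> (\<Sum>DX\<in>PA. \<beta> ^ K)"
  proof (rule sum_mono)
    fix DX assume "DX \<in> PA"
    then obtain D X where DX: "DX = (D, X)" "D \<subseteq> V" "X \<subseteq> V" "card D = K" "card X = K" "X \<inter> D = {}"
      by (auto simp: PA_def P_def Int_commute)
    have ge: "real K / 4 ^ l \<le> (\<Sum>y\<in>D. p {x, y})" if x: "x \<in> X" for x
    proof -
      \<comment> \<open>No level exceeds \<open>l\<close>, so every edge has probability at least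
        \<open>4 ^ -l\<close> and \<open>x\<close> expects at least \<open>K / 4 ^ l\<close>
        neighbors in \<open>D\<close>.\<close>
      have qge: "(1 / 2) ^ l \<le> q v" for v
        unfolding q_def using l by (intro power_decreasing) (auto simp: Suc_le_eq)
      have "(\<Sum>y\<in>D. (1 / 4) ^ l) \<le> (\<Sum>y\<in>D. p {x, y})"
      proof (rule sum_mono)
        fix y assume "y \<in> D"
        then have "p {x, y} = q x * q y" using x DX by (intro pxy) auto
        moreover have "(1 / 2) ^ l * (1 / 2) ^ l \<le> q x * q y" using qge q by (intro mult_mono) auto
        moreover have "(1 / 2) ^ l * (1 / 2) ^ l = ((1 / 4) ^ l :: real)" by (simp flip: power_mult_distrib)
        ultimately show "(1 / 4) ^ l \<le> p {x, y}" by simp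
      qed
      then show ?thesis using DX by (simp add: power_one_over field_simps)
    qed
    have "bexp p (all_edges V) (evA (D, X)) \<le> \<beta> ^ card X"
      unfolding evA_def \<beta>_def prod.case by (rule bexp_few_neighbors[OF V(1) DX(3,2,6) p ge])
    then show "bexp p (all_edges V) (evA DX) \<le> \<beta> ^ K" by (simp only: DX(1,5))
  qed
  also have "\<dots> = real (card PA) * \<beta> ^ K" by simp
  also have "\<dots> \<le> (real n ^ K * real n ^ K) * \<beta> ^ K"
  proof (rule mult_right_mono)
    have "card PA \<le> card (P \<times> P)" using finP by (intro card_mono) (auto simp: PA_def)
    then have "real (card PA) \<le> real (card P) * real (card P)"
      unfolding card_cartesian_product of_nat_mult[symmetric] of_nat_le_iff .
    also have "\<dots> \<le> real n ^ K * real n ^ K" using cP by (intro mult_mono) auto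
    finally show "real (card PA) \<le> real n ^ K * real n ^ K" .
  qed (use \<beta>0 in simp)
  also have "\<dots> = ((real n)\<^sup>2 * \<beta>) ^ K" by (simp add: power_mult_distrib power2_eq_square)
  also have "\<dots> \<le> ((real n)\<^sup>2 * \<beta>) ^ 1" using K a \<beta>0 by (intro power_decreasing) (auto simp: \<beta>_def)
  finally have sumA: "(\<Sum>DX\<in>PA. bexp p (all_edges V) (evA DX)) \<le> 1 / 4" using a by (simp add: \<beta>_def)

  define L where "L i = {v\<in>V. v mod l = i}" for i
  define cls where "cls T f j = {y\<in>T. f y = j}" for T :: "nat set" and f :: "nat \<Rightarrow> nat" and j
  define w where "w T f j = (\<Sum>y\<in>cls T f j. q y)" for T :: "nat set" and f :: "nat \<Rightarrow> nat" and j
  define good where "good T f i \<longleftrightarrow> i < l \<and>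
      (\<Sum>j<r. w T f j * (1 / 2) ^ Suc i * exp (- (w T f j * (1 / 2) ^ Suc i))) \<le> 2 * real r / real l" for T f i
  have "\<exists>i<l. (\<Sum>j<r. w T f j * (1 / 2) ^ Suc i * exp (- (w T f j * (1 / 2) ^ Suc i))) \<le> 2 * real r / real l" for T f
    using l q by (intro exists_scale) (auto simp: w_def intro!: sum_nonneg)
  then have "\<exists>i. good T f i" for T f by (simp add: good_def)
  then have "good T f (SOME i. good T f i)" for T f by (rule someI_ex)
  \<comment> \<open>The favorable level depends only on \<open>T\<close> and \<open>f\<close>, so it
    is fixed before the random graph is drawn.\<close>
  moreover define \<iota> where "\<iota> T f = (SOME i. good T f i)" for T f
  ultimately have \<iota>: "\<And>T f. \<iota> T f < l"
    "\<And>T f. (\<Sum>j<r. w T f j * (1 / 2) ^ Suc (\<iota> T f) * exp (- (w T f j * (1 / 2) ^ Suc (\<iota> T f)))) \<le> 2 * real r / real l"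
    by (simp_all add: good_def)
  \<comment> \<open>One extra label \<open>r\<close> stands for all labels outside the
    \<open>r\<close> classes; extensional maps make the family finite, with
    \<open>(r + 1) ^ M\<close> labelings per set.\<close>
  define IB where "IB = (SIGMA T:{T. T \<subseteq> V \<and> card T = M}. T \<rightarrow>\<^sub>E {..r})"
  have finS: "finite {T. T \<subseteq> V \<and> card T = M}" using V by simp
  have finT: "finite T" if "T \<subseteq> V" for T using that V finite_subset by blast
  have fIB: "finite IB" unfolding IB_def using V finT finS by (intro finite_SigmaI finite_PiE) auto
  have cIB: "real (card IB) \<le> (real n * (real r + 1)) ^ M"
  proof -
    have "card IB = (\<Sum>T | T \<subseteq> V \<and> card T = M. card (T \<rightarrow>\<^sub>E {..r}))"
      unfolding IB_def using finS finT by (intro card_SigmaI) (auto intro!: finite_PiE)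
    also have "\<dots> = (\<Sum>T | T \<subseteq> V \<and> card T = M. Suc r ^ M)"
      using finT by (intro sum.cong) (auto simp: card_PiE)
    also have "\<dots> = (n choose M) * Suc r ^ M" using n_subsets[OF V(1), of M] V(2) by simp
    also have "\<dots> \<le> n ^ M * Suc r ^ M" using K(2) by (intro mult_right_mono binomial_le_pow) auto
    finally have "real (card IB) \<le> real (n ^ M * Suc r ^ M)" by (simp only: of_nat_le_iff)
    then show ?thesis by (simp add: power_mult_distrib add.commute)
  qed
  define evB where "evB = (\<lambda>(T, f) E.
    of_bool (\<forall>x\<in>L (\<iota> T f) - T. \<exists>j<r. card {y\<in>cls T f j. {x, y} \<in> E} = 1) :: real)"
  \<comment> \<open>The constant is \<open>16 / 3 = 8 / 3 * 2\<close>, from the level sum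
    \<open>s = 2 * r / l\<close>.\<close>
  define \<gamma> where "\<gamma> = exp (- exp (- (16 / 3 * (real r / real l))) * (real (n div l) - real M))"
  have "(\<Sum>Tf\<in>IB. bexp p (all_edges V) (evB Tf)) \<le> (\<Sum>Tf\<in>IB. \<gamma>)"
  proof (rule sum_mono)
    fix Tf assume "Tf \<in> IB"
    then obtain T f where Tf: "Tf = (T, f)" "T \<subseteq> V" "card T = M" by (auto simp: IB_def)
    define i where "i = \<iota> T f"
    \<comment> \<open>All these vertices share the value of \<open>q\<close>, so the mean number of
      neighbors in a class is the same for each of them.\<close>
    define X where "X = L i - T"
    have XV: "X \<subseteq> V" "X \<inter> T = {}" by (auto simp: X_def L_def)
    have "bexp p (all_edges V) (evB Tf) \<le> exp (- exp (- (8 / 3 * (2 * real r / real l))) * real (card X))"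
      unfolding Tf evB_def prod.case i_def[symmetric] X_def[symmetric]
    proof (rule bexp_all_unique_class[OF V(1) XV(1) Tf(2) XV(2),
          where \<mu> = "\<lambda>j. w T f j * (1 / 2) ^ Suc i"])
      show "disjoint_family_on (cls T f) {..<r}" by (auto simp: disjoint_family_on_def cls_def)
      show "(\<Sum>j<r. w T f j * (1 / 2) ^ Suc i * exp (- (w T f j * (1 / 2) ^ Suc i))) \<le> 2 * real r / real l"
        using \<iota>(2)[of T f] by (simp add: i_def)
      show "w T f j * (1 / 2) ^ Suc i = (\<Sum>y\<in>cls T f j. p {x, y})" if "x \<in> X" for x j
      proof -
        have "p {x, y} = q y * (1 / 2) ^ Suc i" if "y \<in> cls T f j" for y
        proof -
          have "x \<noteq> y" "q x = (1 / 2) ^ Suc i"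
            using that \<open>x \<in> X\<close> by (auto simp: X_def L_def cls_def q_def)
          then show ?thesis using pxy[OF \<open>x \<noteq> y\<close>] by simp
        qed
        then show ?thesis by (simp add: w_def sum_distrib_right)
      qed
      show "cls T f j \<subseteq> T" for j by (auto simp: cls_def)
      show "0 \<le> p e \<and> p e \<le> 1 / 4" if "e \<in> all_edges V" for e using that by (rule p)
    qed
    also have "\<dots> \<le> \<gamma>"
    proof -
      have "n div l \<le> card (L i)"
        unfolding L_def V_def using \<iota>(1) by (intro card_residue_class_ge) (simp add: i_def)
      moreover have "card (L i) - card T \<le> card X" unfolding X_def using finT[OF Tf(2)] by (rule diff_card_le_card_Diff)
      ultimately have "real (n div l) - real M \<le> real (card X)" using Tf(3) by linarith
      then show ?thesis by (simp add: \<gamma>_def)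
    qed
    finally show "bexp p (all_edges V) (evB Tf) \<le> \<gamma>" .
  qed
  also have "\<dots> = real (card IB) * \<gamma>" by simp
  also have "\<dots> \<le> (real n * (real r + 1)) ^ M * \<gamma>" using cIB by (intro mult_right_mono) (auto simp: \<gamma>_def)
  also have "\<dots> \<le> 1 / 4" using b by (simp add: \<gamma>_def)
  finally have sumB: "(\<Sum>Tf\<in>IB. bexp p (all_edges V) (evB Tf)) \<le> 1 / 4" .

  \<comment> \<open>Fewer than one bad event is expected, so some edge set has a sum of indicators
    below 1, and all of them vanish.\<close>
  have "bexp p (all_edges V) (\<lambda>E. (\<Sum>DX\<in>PA. evA DX E) + (\<Sum>Tf\<in>IB. evB Tf E)) < 1"
    unfolding bexp_add bexp_sum using sumA sumB by linarith
  with finite_all_edges[OF V(1)] p1 obtain E where E: "E \<subseteq> all_edges V"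
    "(\<Sum>DX\<in>PA. evA DX E) + (\<Sum>Tf\<in>IB. evB Tf E) < 1"
    using exists_le_bexp[of "all_edges V" p] by blast
  have nn: "0 \<le> evA DX E" "0 \<le> evB Tf E" for DX Tf
    by (simp_all add: evA_def evB_def split: prod.split)
  have A0: "evA DX E < 1" if "DX \<in> PA" for DX
    using E(2) member_le_sum[OF that, of "\<lambda>DX. evA DX E"] fPA nn sum_nonneg[of IB "\<lambda>Tf. evB Tf E"] by fastforce
  have B0: "evB Tf E < 1" if "Tf \<in> IB" for Tf
    using E(2) member_le_sum[OF that, of "\<lambda>Tf. evB Tf E"] fIB nn sum_nonneg[of PA "\<lambda>DX. evA DX E"] by fastforce
  show thesis
  proof (rule that[OF E(1)])
    fix D X assume "D \<subseteq> V" "X \<subseteq> V" "card D = K" "card X = K" "D \<inter> X = {}"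
    then have "(D, X) \<in> PA" by (simp add: PA_def P_def)
    from A0[OF this] show "\<exists>x\<in>X. \<not> card {y\<in>D. {x, y} \<in> E} \<le> 1"
      unfolding evA_def prod.case by (rule contrapos_pp) simp
  next
    fix T and f :: "nat \<Rightarrow> nat" assume T: "T \<subseteq> V" "card T = M"
    \<comment> \<open>Truncating at \<open>r\<close> leaves the classes below \<open>r\<close>
      unchanged and puts the labeling into the counted family.\<close>
    define f' where "f' = restrict (\<lambda>y. min (f y) r) T"
    have "(T, f') \<in> IB" using T by (auto simp: IB_def f'_def)
    from B0[OF this] have "\<exists>x\<in>L (\<iota> T f') - T. \<forall>j<r. card {y\<in>cls T f' j. {x, y} \<in> E} \<noteq> 1"
      unfolding evB_def prod.case by (rule contrapos_pp) simp
    moreover have "cls T f' j = {y\<in>T. f y = j}" if "j < r" for j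
      using that by (auto simp: cls_def f'_def)
    ultimately show "\<exists>x\<in>V - T. \<forall>j<r. card {y\<in>{y\<in>T. f y = j}. {x, y} \<in> E} \<noteq> 1"
      by (auto simp: L_def)
  qed
qed

section \<open>Choice of parameters for the lower bound\<close>

lemma max_chi_CF_gt:
  fixes n l r K :: nat
  defines "M \<equiv> 2 * r * K"
  assumes "l \<ge> 1" "K \<ge> 1" "M \<le> n"
    and "(real n)\<^sup>2 * (3 * exp (- (real K / 4 ^ l) / 2)) \<le> 1 / 4"
    and "(real n * (real r + 1)) ^ M *
      exp (- exp (- (16 / 3 * (real r / real l))) * (real (n div l) - real M)) \<le> 1 / 4"
  shows "r < max_chi_CF n"
proof -
  obtain E where E: "E \<subseteq> all_edges {..<n}"
    "\<And>D X. D \<subseteq> {..<n} \<Longrightarrow> X \<subseteq> {..<n} \<Longrightarrow> card D = K \<Longrightarrow> card X = K \<Longrightarrow> D \<inter> X = {} \<Longrightarrow>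
       \<exists>x\<in>X. \<not> card {y\<in>D. {x, y} \<in> E} \<le> 1"
    "\<And>T f. T \<subseteq> {..<n} \<Longrightarrow> card T = 2 * r * K \<Longrightarrow>
       \<exists>x\<in>{..<n} - T. \<forall>j<r. card {y\<in>{y\<in>T. f y = j}. {x, y} \<in> E} \<noteq> 1"
    by (rule exists_pseudorandom[OF assms(2,3) assms(4-6)[unfolded M_def]]) auto
  have "r < chi_CF (graph_of {..<n} E)"
    using E assms(4) by (intro chi_CF_gt_of_pseudorandom[where K = K]) (auto simp: M_def)
  also have "\<dots> \<le> max_chi_CF (card (pverts (graph_of {..<n} E)))"
    using E(1) by (intro chi_CF_le_max_chi_CF pair_graph_graph_of) auto
  finally show ?thesis by (simp add: graph_of_def)
qed

text \<open>With \<open>l\<close> about \<open>ln n / 32\<close>, \<open>r = l ^ 2\<close> and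
  \<open>K\<close> about \<open>sqrt n\<close>, there are at most
  \<open>exp (sqrt n * polylog n)\<close> labeled sets. The failure exponent has order
  \<open>n powr (5/6) / ln n\<close> and wins.\<close>

lemma max_chi_CF_lower:
  "eventually (\<lambda>n. (ln (real n) / 64)\<^sup>2 \<le> real (max_chi_CF n)) at_top"
proof -
  \<comment> \<open>A bound for \<open>M = 2 * r * K\<close> free of rounding, so that the
    asymptotic conditions involve only smooth functions of \<open>n\<close>.\<close>
  define Mr where "Mr n = 2 * (ln (real n))\<^sup>2 * (sqrt (real n) + 1)" for n :: nat
  have "eventually (\<lambda>n. ln (real n) \<ge> 64) at_top" by real_asymp
  moreover have "eventually (\<lambda>n. Mr n \<le> real n) at_top" unfolding Mr_def by real_asymp
  moreover have "eventually (\<lambda>n. (real n)\<^sup>2 * (3 * exp (- (real n powr (7/16)) / 2)) \<le> 1 / 4) at_top"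
    by real_asymp
  moreover have "eventually (\<lambda>n. real n / ln (real n) - 1 - Mr n \<ge> 0) at_top"
    unfolding Mr_def by real_asymp
  moreover have "eventually (\<lambda>n. exp (Mr n * ln (real n * ((ln (real n))\<^sup>2 + 1))
      - real n powr (-1/6) * (real n / ln (real n) - 1 - Mr n)) \<le> 1 / 4) at_top"
    unfolding Mr_def by real_asymp
  ultimately show ?thesis
  proof eventually_elim
    case (elim n)
    define x where "x = ln (real n)"
    define l where "l = nat \<lfloor>x / 32\<rfloor>"
    define r where "r = l\<^sup>2"
    define K where "K = nat \<lceil>sqrt (real n)\<rceil>"
    define M where "M = 2 * r * K"
    have x: "x \<ge> 64" using elim by (simp add: x_def)
    then have n: "real n > 1" by (cases "n = 0 \<or> n = 1") (auto simp: x_def)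
    \<comment> \<open>Here \<open>x \<ge> 64\<close> pays for the rounding: the floor of
      \<open>x / 32\<close> is at least \<open>x / 32 - 1 \<ge> x / 64\<close>.\<close>
    have l: "real l \<le> x / 32" "real l \<ge> x / 64" "l \<ge> 1" unfolding l_def using x by linarith+
    have s: "sqrt (real n) \<ge> 1" using n by simp
    then have K: "sqrt (real n) \<le> real K" "real K \<le> sqrt (real n) + 1" "K \<ge> 1"
      unfolding K_def by linarith+
    have rx: "real r \<le> x\<^sup>2" unfolding r_def of_nat_power using l x by (intro power_mono) auto
    have "real M \<le> 2 * x\<^sup>2 * (sqrt (real n) + 1)"
      unfolding M_def of_nat_mult using rx K by (intro mult_mono) auto
    then have M: "real M \<le> Mr n" by (simp add: Mr_def x_def)
    have "r < max_chi_CF n"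
    proof (rule max_chi_CF_gt[OF l(3) K(3)])
      have "real M \<le> real n" using M elim by linarith
      then show "2 * r * K \<le> n" unfolding M_def by linarith
      have "real n powr (7/16) \<le> real K / 4 ^ l"
      proof -
        have "(4 :: real) \<le> exp 2"
        proof -
          have "(2::real) \<le> exp 1" using exp_ge_add_one_self[of 1] by simp
          then have "(2::real) * 2 \<le> exp 1 * exp 1" by (intro mult_mono) auto
          then show ?thesis by (simp flip: exp_add)
        qed
        then have "(4 :: real) ^ l \<le> exp 2 ^ l" by (intro power_mono) auto
        also have "\<dots> = exp (real l * 2)" by (simp only: exp_of_nat_mult)
        also have "\<dots> \<le> exp (x / 16)" using l by simp
        also have "\<dots> = real n powr (1/16)" using n by (simp add: powr_def x_def)
        finally have 4: "(4 :: real) ^ l \<le> real n powr (1/16)" .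
        have "real n powr (7/16) = real n powr (1/2) / real n powr (1/16)"
          by (simp flip: powr_diff)
        also have "\<dots> \<le> real K / 4 ^ l"
          using K 4 n by (intro frac_le) (auto simp: powr_half_sqrt)
        finally show ?thesis .
      qed
      then have "(real n)\<^sup>2 * (3 * exp (- (real K / 4 ^ l) / 2)) \<le> (real n)\<^sup>2 * (3 * exp (- (real n powr (7/16)) / 2))"
        by (intro mult_left_mono) auto
      with elim show "(real n)\<^sup>2 * (3 * exp (- (real K / 4 ^ l) / 2)) \<le> 1 / 4" by linarith
      have "(real n * (real r + 1)) ^ M * exp (- exp (- (16 / 3 * (real r / real l))) * (real (n div l) - real M))
        \<le> exp (Mr n * ln (real n * (x\<^sup>2 + 1))) * exp (- (real n powr (-1/6) * (real n / x - 1 - Mr n)))"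
      proof (rule mult_mono)
        have "real n * (x\<^sup>2 + 1) \<ge> 1 * 1" using n by (intro mult_mono) auto
        then have ge1: "real n * (x\<^sup>2 + 1) \<ge> 1" by simp
        have "(real n * (real r + 1)) ^ M \<le> (real n * (x\<^sup>2 + 1)) ^ M"
          using rx n by (intro power_mono mult_left_mono) auto
        also have "\<dots> = exp (ln (real n * (x\<^sup>2 + 1))) ^ M" using ge1 by simp
        also have "\<dots> = exp (real M * ln (real n * (x\<^sup>2 + 1)))" by (simp only: exp_of_nat_mult)
        also have "\<dots> \<le> exp (Mr n * ln (real n * (x\<^sup>2 + 1)))"
          using M ge1 by (simp add: mult_right_mono)
        finally show "(real n * (real r + 1)) ^ M \<le> exp (Mr n * ln (real n * (x\<^sup>2 + 1)))" .
        have "real n powr (-1/6) * (real n / x - 1 - Mr n) \<le>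
            exp (- (16 / 3 * (real r / real l))) * (real (n div l) - real M)"
        proof (rule mult_mono)
          \<comment> \<open>Now \<open>l \<le> x / 32\<close> turns the exponent 16/3 into
            \<open>16 / 3 / 32 = 1 / 6\<close>.\<close>
          have "real r / real l = real l" using l(3) by (simp add: r_def power2_eq_square)
          then show "real n powr (-1/6) \<le> exp (- (16 / 3 * (real r / real l)))"
            using l n by (simp add: powr_def x_def)
          have "real n / x \<le> real n / real l" using l x by (intro divide_left_mono) auto
          moreover have "real n / real l \<le> real (n div l) + 1"
            using l(3) by (metis add.commute floor_divide_of_nat_eq of_int_of_nat_eq le_less real_of_int_floor_add_one_gt)
          ultimately show "real n / x - 1 - Mr n \<le> real (n div l) - real M" using M by linarith
        qed (use elim in \<open>auto simp: x_def\<close>)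
        then show "exp (- exp (- (16 / 3 * (real r / real l))) * (real (n div l) - real M))
          \<le> exp (- (real n powr (-1/6) * (real n / x - 1 - Mr n)))" by simp
      qed auto
      also have "\<dots> = exp (Mr n * ln (real n * (x\<^sup>2 + 1)) - real n powr (-1/6) * (real n / x - 1 - Mr n))"
        by (simp add: mult_exp_exp)
      also have "\<dots> \<le> 1 / 4" using elim by (simp add: x_def)
      finally show "(real n * (real r + 1)) ^ (2 * r * K) *
        exp (- exp (- (16 / 3 * (real r / real l))) * (real (n div l) - real (2 * r * K))) \<le> 1 / 4"
        unfolding M_def .
    qed
    moreover have "(x / 64)\<^sup>2 \<le> real r" unfolding r_def of_nat_power using l x by (intro power_mono) auto
    ultimately show ?case by (simp add: x_def)
  qed
qed

theorem theorem4:
  shows "(\<lambda>n. real (max_chi_CF n)) \<in> \<Theta>[at_top](\<lambda>n. (ln (real n))\<^sup>2)"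
proof (rule bigthetaI)
  have "eventually (\<lambda>n. norm (real (max_chi_CF n)) \<le> 102 * norm ((ln (real n))\<^sup>2)) at_top"
    using eventually_ge_at_top[of 3] by eventually_elim (simp add: max_chi_CF_upper)
  then show "(\<lambda>n. real (max_chi_CF n)) \<in> O(\<lambda>n. (ln (real n))\<^sup>2)" by (rule bigoI)
  have "eventually (\<lambda>n. norm ((ln (real n))\<^sup>2) \<le> 64\<^sup>2 * norm (real (max_chi_CF n))) at_top"
    using max_chi_CF_lower by eventually_elim (simp add: power_divide field_simps)
  then have "(\<lambda>n. (ln (real n))\<^sup>2) \<in> O(\<lambda>n. real (max_chi_CF n))" by (rule bigoI)
  then show "(\<lambda>n. real (max_chi_CF n)) \<in> \<Omega>(\<lambda>n. (ln (real n))\<^sup>2)"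
    by (simp add: bigomega_iff_bigo)
qed

end
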